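(* Let $q$ and $k$ be nonnegative integers and let $G$ be a balanced bipartite graph with $|V(G)|=2n\ge 8k(k+1)$. If $\delta(G)\ge k\ge q+1$ and if either $\rho(G)\ge\rho(F^0_{n,k,q+1})$ or $\mu(G)\ge\mu(F^0_{n,k,q+1})$, then $G$ is $(q,q)$-Hamiltonian unless $G\in\{F_{n,k,q+1},\,F^0_{n,k,q+1}\}$.
   Context: Graphs are finite, simple and undirected; equality of graphs is up to isomorphism. A bipartite graph $G=[U,V]$ is balanced if $|U|=|V|$. $\delta(G)$ is the minimum degree, $\rho(G)$ is the largest eigenvalue of the adjacency matrix $A(G)$, and $\mu(G)$ is the largest eigenvalue of $A(G)+D(G)$, where $D(G)$ is the diagonal degree matrix. A balanced bipartite graph $G=[U,V]$ is $(q,q)$-Hamiltonian if for every $S\subset V(G)$ with $|S\cap U|=|S\cap V|=q$, the graph $G-S$ contains a spanning cycle. For integers $n>k\ge 0$, $a\ge k+1$, $b\ge1$, let $(X,Y)$ be the bipartition of $K_{n,a+b}$ with $|X|=n$, $|Y|=a+b$, let $X_1\subset X$ with $|X_1|=n-k$ and $Y_1\subset Y$ with $|Y_1|=b$. Then $Z_{a,b}$ (depending also on $n,k$) is the graph obtained from $K_{n,a+b}$ by deleting all edges between $X_1$ and $Y_1$, and $Z^0_{a,b}=Z_{a,b}-e$, where $e=uv$ is an edge of $Z_{a,b}$ with $u\in Y\setminus Y_1$ (so $d(u)=n$) and $v\in X_1$ (so $d(v)=a$). Define $F_{n,k,s}=Z_{n+s-k-1,\,k+1-s}$ and $F^0_{n,k,s}=Z^0_{n+s-k-1,\,k+1-s}$.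 *)

theory Defs
  imports
    "Graph_Theory.Pair_Digraph"
    "Graph_Theory.Digraph_Component"
    "Graph_Theory.Digraph_Isomorphism"
    "Jordan_Normal_Form.Spectral_Radius"
begin

text \<open>
  A finite simple undirected graph is a \<^locale>\<open>pair_graph\<close>: every edge \<open>uv\<close> is stored as the two
  arcs \<open>(u,v)\<close> and \<open>(v,u)\<close>.  Hence the degree of a vertex is its out-degree.
\<close>

definition min_degree :: "'a pair_pre_digraph \<Rightarrow> nat" where
  "min_degree G = Min (out_degree G ` pverts G)"

definition balanced_bipartition :: "'a pair_pre_digraph \<Rightarrow> 'a set \<Rightarrow> 'a set \<Rightarrow> bool" where
  "balanced_bipartition G U V \<longleftrightarrow>
     U \<union> V = pverts G \<and> U \<inter> V = {} \<and> parcs G \<subseteq> U \<times> V \<union> V \<times> U \<and> card U = card V"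

text \<open>
  In the library's symmetric digraphs, going along an edge and back is a \<^term>\<open>pre_digraph.cycle\<close>
  of length 2; the length bound excludes it, as usual for undirected graphs.
\<close>

definition has_spanning_cycle :: "('a, 'b) pre_digraph \<Rightarrow> bool" where
  "has_spanning_cycle G \<longleftrightarrow>
     (\<exists>p. pre_digraph.cycle G p \<and> 3 \<le> length p \<and> tail G ` set p = verts G)"

definition qq_Hamiltonian :: "nat \<Rightarrow> 'a pair_pre_digraph \<Rightarrow> 'a set \<Rightarrow> 'a set \<Rightarrow> bool" where
  "qq_Hamiltonian q G U V \<longleftrightarrow>
     (\<forall>S \<subseteq> pverts G. card (S \<inter> U) = q \<and> card (S \<inter> V) = q \<longrightarrow>
        has_spanning_cycle (with_proj G \<restriction> (pverts G - S)))"

text \<open>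
  Matrices are indexed by positions in an arbitrary but fixed enumeration of the vertices; another
  enumeration gives a matrix that is similar via a permutation, so the spectrum is unaffected.
\<close>

definition vertex_list :: "'a pair_pre_digraph \<Rightarrow> 'a list" where
  "vertex_list G = (SOME vs. distinct vs \<and> set vs = pverts G)"

definition adjacency_matrix :: "'a pair_pre_digraph \<Rightarrow> real mat" where
  "adjacency_matrix G = (let vs = vertex_list G in
     mat (length vs) (length vs) (\<lambda>(i, j). if (vs ! i, vs ! j) \<in> parcs G then 1 else 0))"

definition degree_matrix :: "'a pair_pre_digraph \<Rightarrow> real mat" where
  "degree_matrix G = (let vs = vertex_list G in
     mat (length vs) (length vs) (\<lambda>(i, j). if i = j then real (out_degree G (vs ! i)) else 0))"

definition adj_spectral_radius :: "'a pair_pre_digraph \<Rightarrow> real" where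
  "adj_spectral_radius G = Max (spectrum (adjacency_matrix G))"

definition signless_spectral_radius :: "'a pair_pre_digraph \<Rightarrow> real" where
  "signless_spectral_radius G = Max (spectrum (adjacency_matrix G + degree_matrix G))"

text \<open>
  \<open>X = Inl ` {..<n}\<close>, \<open>Y = Inr ` {..<a + b}\<close>, \<open>X\<^sub>1 = Inl ` {..<n - k}\<close>, \<open>Y\<^sub>1 = Inr ` {..<b}\<close>.
  The definitions are intended for \<open>k < n\<close>, \<open>k + 1 \<le> a\<close> and \<open>1 \<le> b\<close>.
\<close>

definition Z_edges :: "nat \<Rightarrow> nat \<Rightarrow> nat \<Rightarrow> nat \<Rightarrow> (nat + nat) rel" where
  "Z_edges n k a b =
     Inl ` {..<n} \<times> Inr ` {..<a + b} - Inl ` {..<n - k} \<times> Inr ` {..<b}"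

definition Z_graph :: "nat \<Rightarrow> nat \<Rightarrow> nat \<Rightarrow> nat \<Rightarrow> (nat + nat) pair_pre_digraph" where
  "Z_graph n k a b =
     \<lparr> pverts = Inl ` {..<n} \<union> Inr ` {..<a + b},
       parcs = Z_edges n k a b \<union> (Z_edges n k a b)\<inverse> \<rparr>"

text \<open>
  The deleted edge joins \<open>Inr b\<close>, a vertex of \<open>Y - Y\<^sub>1\<close>, to \<open>Inl 0\<close>, a vertex of \<open>X\<^sub>1\<close>.  All
  edges between \<open>Y - Y\<^sub>1\<close> and \<open>X\<^sub>1\<close> are equivalent under automorphisms of \<open>Z_graph n k a b\<close>.
\<close>

definition Z0_graph :: "nat \<Rightarrow> nat \<Rightarrow> nat \<Rightarrow> nat \<Rightarrow> (nat + nat) pair_pre_digraph" where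
  "Z0_graph n k a b =
     \<lparr> pverts = pverts (Z_graph n k a b),
       parcs = parcs (Z_graph n k a b) - {(Inl 0, Inr b), (Inr b, Inl 0)} \<rparr>"

definition F_graph :: "nat \<Rightarrow> nat \<Rightarrow> nat \<Rightarrow> (nat + nat) pair_pre_digraph" where
  "F_graph n k s = Z_graph n k (n + s - k - 1) (k + 1 - s)"

definition F0_graph :: "nat \<Rightarrow> nat \<Rightarrow> nat \<Rightarrow> (nat + nat) pair_pre_digraph" where
  "F0_graph n k s = Z0_graph n k (n + s - k - 1) (k + 1 - s)"

end

theory Submission
  imports
    Defs
    "HOL-Analysis.Function_Topology"
    "HOL-Analysis.Convex"
    "HOL-Number_Theory.Cong"
begin

text \<open>
  Put \<open>b = k - q\<close> and describe \<open>G\<close> by the set \<open>B\<close> of its edges, directed from \<open>U\<close> to \<open>V\<close>.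

  Either spectral hypothesis forces \<open>G\<close> to be nearly as dense as \<open>F\<close>.  On the one hand
  \<open>\<rho>(G)\<^sup>2 \<le> |B|\<close> by Cauchy-Schwarz (\<open>adjacency_radius_square_le_edges\<close>), and
  \<open>\<mu>(G) \<le> |B|/n + n\<close> by weighting the eigenvector equation with the degrees
  (\<open>signless_radius_le_edges\<close>).  On the other hand \<open>F\<^sup>0\<close> is a perturbation of a complete bipartite
  graph, and test functions modelled on the eigenvectors of the latter give
  \<open>\<rho>(F\<^sup>0)\<^sup>2 > n(n - b) - 2\<close> and \<open>\<mu>(F\<^sup>0) > (n(n - b) - 2)/n + n\<close>.  Since \<open>|B|\<close> is an integer, \<open>G\<close> has
  at most \<open>nb + 1\<close> non-edges (\<open>nonedges_le\<close>).

  Suppose that deleting \<open>q\<close> vertices on each side leaves a graph without a spanning cycle, and let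
  \<open>m = n - q\<close>.  An edge-maximal non-Hamiltonian supergraph satisfies \<open>d(u) + d(v) \<le> m\<close> for all
  non-adjacent \<open>u\<close> and \<open>v\<close> (\<open>maximal_nonhamiltonian_supergraph\<close>).  A non-adjacent pair of largest
  degree sum then yields \<open>t\<close> vertices of degree at most \<open>t\<close> on one side, where \<open>b \<le> t \<le> m - b\<close>, and
  hence at least \<open>t(m - t)\<close> non-edges.  This exceeds \<open>nb + 1\<close> unless \<open>t\<close> is at an end of its range,
  and what remains is rigid: on one side there is a set \<open>T\<close> of \<open>b\<close> vertices that have only \<open>b\<close>
  neighbours altogether (\<open>sparse_block_if_ore_maximal\<close>).  Putting the deleted vertices back,
  \<open>T\<close> has at most \<open>k\<close> neighbours in \<open>G\<close>, and by \<open>\<delta>(G) \<ge> k\<close> each vertex of \<open>T\<close> is adjacent to all of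
  them.  So \<open>G\<close> is a spanning subgraph of \<open>F\<close>, and no edge at \<open>T\<close> is missing.

  It remains to see that such a \<open>G\<close>, if it is neither \<open>F\<close> nor \<open>F\<^sup>0\<close>, has a smaller spectral radius
  than \<open>F\<^sup>0\<close> (\<open>radius_less_some_block\<close>).  Let \<open>N\<close> be the neighbourhood of \<open>T\<close>.  If an edge is missing
  that does not meet \<open>N\<close>, then \<open>G\<close> is a proper subgraph of a copy of \<open>F\<^sup>0\<close> and the Perron-Frobenius
  argument applies.  Otherwise let \<open>yx\<close> be missing, with \<open>x\<close> in \<open>N\<close>, let \<open>x\<^sub>0\<close> be on the side of \<open>x\<close>
  but outside \<open>N\<close>, and let \<open>f\<close> be a non-negative top eigenfunction of \<open>G\<close>.  If \<open>f(x\<^sub>0) \<le> f(x)\<close>,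
  exchange the edge \<open>yx\<^sub>0\<close> for \<open>yx\<close>; if \<open>f(x) < f(x\<^sub>0)\<close>, exchange the edges between \<open>T\<close> and \<open>x\<close> for
  those between \<open>T\<close> and \<open>x\<^sub>0\<close>.  Neither exchange decreases the quadratic form at \<open>f\<close>, and both lead
  to a subgraph of a copy of \<open>F\<^sup>0\<close>.

  Both spectral radii are treated at once, as the top eigenvalue of \<open>A + c D\<close> with \<open>c\<close> equal to 0 or 1.
\<close>

section \<open>Largest eigenvalues of symmetric kernels on finite sets\<close>

text \<open>
  The spectra are studied through functions on the vertex set rather than through vectors, so that no
  enumeration of the vertices has to be carried along.
\<close>

definition eigenfunction :: "'a set \<Rightarrow> ('a \<Rightarrow> 'a \<Rightarrow> real) \<Rightarrow> real \<Rightarrow> ('a \<Rightarrow> real) \<Rightarrow> bool" where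
  "eigenfunction P m l f \<longleftrightarrow>
     (\<exists>u\<in>P. f u \<noteq> 0) \<and> (\<forall>u\<in>P. (\<Sum>v\<in>P. m u v * f v) = l * f u)"

definition eigenvalues_on :: "'a set \<Rightarrow> ('a \<Rightarrow> 'a \<Rightarrow> real) \<Rightarrow> real set" where
  "eigenvalues_on P m = {l. \<exists>f. eigenfunction P m l f}"

definition max_eigenvalue :: "'a set \<Rightarrow> ('a \<Rightarrow> 'a \<Rightarrow> real) \<Rightarrow> real" where
  "max_eigenvalue P m = Max (eigenvalues_on P m)"

definition quad_form :: "'a set \<Rightarrow> ('a \<Rightarrow> 'a \<Rightarrow> real) \<Rightarrow> ('a \<Rightarrow> real) \<Rightarrow> real" where
  "quad_form P m f = (\<Sum>u\<in>P. \<Sum>v\<in>P. m u v * f u * f v)"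

lemma spectrum_mat_eq_eigenvalues_on:
  assumes "distinct vs" "set vs = P"
  shows "spectrum (mat (length vs) (length vs) (\<lambda>(i, j). m (vs ! i) (vs ! j))) = eigenvalues_on P m"
    (is "spectrum ?A = _")
proof -
  let ?n = "length vs"
  have bij: "bij_betw ((!) vs) {..<?n} P"
    using assms bij_betw_nth by blast
  have row: "(?A *\<^sub>v x) $ i = (\<Sum>j<?n. m (vs ! i) (vs ! j) * x $ j)"
    if "x \<in> carrier_vec ?n" "i < ?n" for x i
    using that by (simp add: scalar_prod_def lessThan_atLeast0)
  have "l \<in> eigenvalues_on P m" if "eigenvector ?A x l" for x l
  proof -
    have x: "x \<in> carrier_vec ?n" "x \<noteq> 0\<^sub>v ?n" "?A *\<^sub>v x = l \<cdot>\<^sub>v x"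
      using that by (auto simp: eigenvector_def)
    define f where "f u = x $ (the_inv_into {..<?n} ((!) vs) u)" for u
    have f: "f (vs ! i) = x $ i" if "i < ?n" for i
      using bij that by (simp add: f_def bij_betw_def the_inv_into_f_f)
    obtain i where i: "i < ?n" "x $ i \<noteq> 0"
      using x(1,2) by (auto simp: vec_eq_iff carrier_vecD)
    have "(\<Sum>v\<in>P. m u v * f v) = l * f u" if "u \<in> P" for u
    proof -
      have "\<exists>i<?n. vs ! i = u"
        using that by (simp only: assms(2)[symmetric] in_set_conv_nth)
      then obtain i where i: "i < ?n" "u = vs ! i" by auto
      have "(\<Sum>v\<in>P. m u v * f v) = (\<Sum>j<?n. m u (vs ! j) * f (vs ! j))"
        by (rule sum.reindex_bij_betw[OF bij, symmetric])
      also have "\<dots> = (?A *\<^sub>v x) $ i"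
        using i x(1) by (simp only: row) (auto intro!: sum.cong simp: f)
      also have "\<dots> = l * f u"
        unfolding x(3) using x(1) i by (simp add: f)
      finally show ?thesis .
    qed
    moreover have "vs ! i \<in> P" using i assms by auto
    ultimately show ?thesis
      using i f[OF i(1)] by (auto simp: eigenvalues_on_def eigenfunction_def intro!: exI[of _ f] bexI[of _ "vs ! i"])
  qed
  moreover have "eigenvector ?A (vec ?n (\<lambda>i. f (vs ! i))) l"
    if f: "eigenfunction P m l f" for f l
  proof -
    obtain u where u: "u \<in> P" "f u \<noteq> 0" using f by (auto simp: eigenfunction_def)
    let ?x = "vec ?n (\<lambda>i. f (vs ! i))"
    have "\<exists>i<?n. vs ! i = u"
      using u(1) by (simp only: assms(2)[symmetric] in_set_conv_nth)
    then obtain i where i: "i < ?n" "u = vs ! i" by auto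
    have "?x \<noteq> 0\<^sub>v ?n"
      using i u(2) by (metis index_vec index_zero_vec(1))
    moreover have "?A *\<^sub>v ?x = l \<cdot>\<^sub>v ?x"
    proof (rule eq_vecI)
      fix i assume "i < dim_vec (l \<cdot>\<^sub>v ?x)"
      then have i: "i < ?n" by simp
      have "(?A *\<^sub>v ?x) $ i = (\<Sum>j<?n. m (vs ! i) (vs ! j) * f (vs ! j))"
        using i by (subst row) auto
      also have "\<dots> = (\<Sum>v\<in>P. m (vs ! i) v * f v)"
        by (rule sum.reindex_bij_betw[OF bij])
      also have "\<dots> = l * f (vs ! i)" using f i assms by (auto simp: eigenfunction_def)
      finally show "(?A *\<^sub>v ?x) $ i = (l \<cdot>\<^sub>v ?x) $ i" using i by simp
    qed simp
    ultimately show ?thesis by (simp add: eigenvector_def)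
  qed
  ultimately show ?thesis
    unfolding spectrum_def eigenvalue_def eigenvalues_on_def by blast
qed

lemma finite_eigenvalues_on:
  assumes "finite P" shows "finite (eigenvalues_on P m)"
proof -
  obtain vs where "distinct vs" "set vs = P" using finite_distinct_list[OF assms] by blast
  then show ?thesis
    using card_finite_spectrum(1)[OF mat_carrier] spectrum_mat_eq_eigenvalues_on by metis
qed

lemma eigenvalues_on_reindex_subset:
  assumes "bij_betw h P Q"
  shows "eigenvalues_on Q m \<subseteq> eigenvalues_on P (\<lambda>u v. m (h u) (h v))"
proof
  fix l assume "l \<in> eigenvalues_on Q m"
  then obtain f where f: "eigenfunction Q m l f" unfolding eigenvalues_on_def by blast
  have "(\<Sum>v\<in>P. m (h u) (h v) * f (h v)) = l * f (h u)" if "u \<in> P" for u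
  proof -
    have "h u \<in> Q" using assms that by (auto simp: bij_betw_def)
    then show ?thesis
      using f sum.reindex_bij_betw[OF assms, of "\<lambda>v. m (h u) v * f v"]
      by (simp add: eigenfunction_def)
  qed
  moreover have "\<exists>w\<in>P. f (h w) \<noteq> 0"
    using f assms by (auto simp: eigenfunction_def bij_betw_def)
  ultimately have "eigenfunction P (\<lambda>u v. m (h u) (h v)) l (\<lambda>u. f (h u))"
    unfolding eigenfunction_def by blast
  then show "l \<in> eigenvalues_on P (\<lambda>u v. m (h u) (h v))"
    unfolding eigenvalues_on_def by blast
qed

lemma eigenvalues_on_cong:
  assumes "\<And>u v. u \<in> P \<Longrightarrow> v \<in> P \<Longrightarrow> m u v = m' u v"
  shows "eigenvalues_on P m = eigenvalues_on P m'"
proof -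
  have "(\<Sum>v\<in>P. m u v * f v) = (\<Sum>v\<in>P. m' u v * f v)" if "u \<in> P" for u f
    using assms that by (intro sum.cong) auto
  then show ?thesis unfolding eigenvalues_on_def eigenfunction_def by simp
qed

text \<open>
  Isomorphic graphs have the same spectra although their vertices have different types.
\<close>

lemma max_eigenvalue_reindex:
  assumes "bij_betw h P Q" "\<And>u v. u \<in> P \<Longrightarrow> v \<in> P \<Longrightarrow> m u v = m' (h u) (h v)"
  shows "max_eigenvalue P m = max_eigenvalue Q m'"
proof -
  let ?g = "the_inv_into P h"
  have g: "bij_betw ?g Q P" using bij_betw_the_inv_into[OF assms(1)] .
  have m: "m (?g u) (?g v) = m' u v" if "u \<in> Q" "v \<in> Q" for u v
    using that assms(2)[of "?g u" "?g v"] bij_betwE[OF g] f_the_inv_into_f_bij_betw[OF assms(1)] by simp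
  have "eigenvalues_on Q m' \<subseteq> eigenvalues_on P m"
    using eigenvalues_on_reindex_subset[OF assms(1), of m']
      eigenvalues_on_cong[of P m "\<lambda>u v. m' (h u) (h v)"] assms(2) by auto
  moreover have "eigenvalues_on P m \<subseteq> eigenvalues_on Q m'"
    using eigenvalues_on_reindex_subset[OF g, of m]
      eigenvalues_on_cong[of Q m' "\<lambda>u v. m (?g u) (?g v)"] m by auto
  ultimately show ?thesis unfolding max_eigenvalue_def by simp
qed

text \<open>
  Near 0 the linear term dominates the quadratic one.
\<close>

lemma linear_coeff_zero_if_quadratic_nonpos:
  fixes a c :: real
  assumes "\<And>t. t * a + t^2 * c \<le> 0"
  shows "a = 0"
proof (rule ccontr)
  assume "a \<noteq> 0"
  define s where "s = 1 / (\<bar>c\<bar> + 1)"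
  have s: "s > 0" "s * \<bar>c\<bar> < 1" by (auto simp: s_def field_simps)
  have "(s * a) * a + (s * a)^2 * c = s * a^2 * (1 + s * c)"
    by (simp add: power2_eq_square algebra_simps)
  moreover have "s * (- \<bar>c\<bar>) \<le> s * c" using s(1) by (intro mult_left_mono) auto
  then have "s * c > -1" using s(2) by simp
  then have "s * a^2 * (1 + s * c) > 0" using \<open>a \<noteq> 0\<close> s(1) by simp
  ultimately show False using assms[of "s * a"] by linarith
qed

lemma quad_form_shift:
  assumes "finite P" "z \<in> P" and sym: "\<And>u v. u \<in> P \<Longrightarrow> v \<in> P \<Longrightarrow> m u v = m v u"
  shows "quad_form P m (\<lambda>u. f u + (if u = z then t else 0)) =
         quad_form P m f + 2 * t * (\<Sum>v\<in>P. m z v * f v) + t^2 * m z z"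
proof -
  let ?d = "\<lambda>u. if u = z then t else (0::real)"
  have "quad_form P m (\<lambda>u. f u + ?d u) =
      quad_form P m f + (\<Sum>u\<in>P. \<Sum>v\<in>P. m u v * f u * ?d v) +
      (\<Sum>u\<in>P. \<Sum>v\<in>P. m u v * ?d u * f v) + (\<Sum>u\<in>P. \<Sum>v\<in>P. m u v * ?d u * ?d v)"
    unfolding quad_form_def by (simp only: sum.distrib[symmetric]) (simp add: algebra_simps)
  also have "(\<Sum>u\<in>P. \<Sum>v\<in>P. m u v * f u * ?d v) = (\<Sum>u\<in>P. m u z * f u * t)"
    using assms(1,2) by (simp add: if_distrib[of "\<lambda>x. _ * x"] cong: if_cong)
  also have "\<dots> = t * (\<Sum>v\<in>P. m z v * f v)"
    unfolding sum_distrib_left using assms by (intro sum.cong) auto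
  also have "(\<Sum>u\<in>P. \<Sum>v\<in>P. m u v * ?d u * f v) = (\<Sum>u\<in>P. if u = z then t * (\<Sum>v\<in>P. m z v * f v) else 0)"
    by (intro sum.cong) (auto simp: sum_distrib_left mult_ac)
  also have "\<dots> = t * (\<Sum>v\<in>P. m z v * f v)" using assms(1,2) by simp
  also have "(\<Sum>u\<in>P. \<Sum>v\<in>P. m u v * ?d u * ?d v) = (\<Sum>u\<in>P. m u z * ?d u * t)"
    using assms(1,2) by (simp add: if_distrib[of "\<lambda>x. _ * x"] cong: if_cong)
  also have "\<dots> = t^2 * m z z"
    using assms(1,2) by (simp add: if_distrib[of "\<lambda>x. _ * x"] if_distrib[of "\<lambda>x. x * _"] power2_eq_square mult_ac cong: if_cong)
  finally show ?thesis by (simp add: algebra_simps)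
qed

text \<open>
  At a maximum of the Rayleigh quotient the derivative in every coordinate direction \<open>z\<close> vanishes;
  by \<open>quad_form_shift\<close> this is the \<open>z\<close>-th coordinate of the eigenvector equation.
\<close>

lemma rayleigh_maximizer_is_eigenfunction:
  assumes "finite P" and sym: "\<And>u v. u \<in> P \<Longrightarrow> v \<in> P \<Longrightarrow> m u v = m v u"
    and bound: "\<And>g. quad_form P m g \<le> L * (\<Sum>u\<in>P. (g u)^2)"
    and eq: "quad_form P m f = L * (\<Sum>u\<in>P. (f u)^2)"
    and "z \<in> P"
  shows "(\<Sum>v\<in>P. m z v * f v) = L * f z"
proof -
  have "t * (2 * ((\<Sum>v\<in>P. m z v * f v) - L * f z)) + t^2 * (m z z - L) \<le> 0" for t
  proof -
    let ?d = "\<lambda>u. if u = z then t else (0::real)"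
    have "(\<Sum>u\<in>P. (f u + ?d u)^2) = (\<Sum>u\<in>P. (f u)^2 + (if u = z then 2 * t * f z + t^2 else 0))"
      by (intro sum.cong) (auto simp: power2_sum)
    also have "\<dots> = (\<Sum>u\<in>P. (f u)^2) + (2 * t * f z + t^2)"
      using assms(1,5) by (simp add: sum.distrib)
    finally have "quad_form P m (\<lambda>u. f u + ?d u) \<le> L * ((\<Sum>u\<in>P. (f u)^2) + (2 * t * f z + t^2))"
      using bound[of "\<lambda>u. f u + ?d u"] by simp
    then show ?thesis
      using quad_form_shift[of P z m f t, OF assms(1) \<open>z \<in> P\<close> sym] eq by (simp add: algebra_simps)
  qed
  then have "2 * ((\<Sum>v\<in>P. m z v * f v) - L * f z) = 0"
    by (rule linear_coeff_zero_if_quadratic_nonpos)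
  then show ?thesis by simp
qed

text \<open>
  The unit sphere of the functions supported on \<open>P\<close> is compact: it is a closed subset of a product of
  compact intervals.
\<close>

lemma exists_rayleigh_maximizer:
  assumes "finite P" "P \<noteq> {}"
  shows "\<exists>L f. (\<Sum>u\<in>P. (f u)^2) = 1 \<and> quad_form P m f = L \<and>
    (\<forall>g. quad_form P m g \<le> L * (\<Sum>u\<in>P. (g u)^2))"
proof -
  define C :: "('a \<Rightarrow> real) set" where "C = PiE UNIV (\<lambda>u. if u \<in> P then {-1..1} else {0})"
  have "compactin (product_topology (\<lambda>i::'a. euclidean) UNIV) C"
    unfolding C_def by (subst compactin_PiE) (auto simp: compactin_euclidean_iff)
  then have C: "compact C"
    using euclidean_product_topology[where 'a='a and 'b=real] by (metis compactin_euclidean_iff)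
  let ?N = "\<lambda>f::'a \<Rightarrow> real. \<Sum>u\<in>P. (f u)^2"
  have contN: "continuous_on UNIV ?N"
    by (intro continuous_intros) simp
  have contQ: "continuous_on UNIV (quad_form P m)"
    unfolding quad_form_def by (intro continuous_intros) simp_all
  have "closed {f. ?N f = 1}"
    using closed_vimage[OF _ contN, of "{1}"] by (simp add: vimage_def)
  with C have K: "compact (C \<inter> {f. ?N f = 1})" by (rule compact_Int_closed)
  have norm: "(\<lambda>u. if u \<in> P then f u else 0) \<in> C \<inter> {f. ?N f = 1}" if "?N f = 1" for f
  proof -
    have "f u \<in> {-1..1}" if "u \<in> P" for u
    proof -
      have "(f u)^2 \<le> 1"
        using member_le_sum[of u P "\<lambda>u. (f u)^2"] assms that \<open>?N f = 1\<close> by auto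
      then show ?thesis by (auto simp: abs_square_le_1)
    qed
    then show ?thesis using that by (auto simp: C_def)
  qed
  obtain z where z: "z \<in> P" using assms by blast
  have "?N (\<lambda>u. if u = z then 1 else 0) = 1"
    using z assms(1) by (simp add: if_distrib[of "\<lambda>x. x^2"] cong: if_cong)
  from norm[OF this] have ne: "C \<inter> {f. ?N f = 1} \<noteq> {}" by blast
  obtain f where f: "f \<in> C \<inter> {f. ?N f = 1}"
    "\<And>g. g \<in> C \<inter> {f. ?N f = 1} \<Longrightarrow> quad_form P m g \<le> quad_form P m f"
    using continuous_attains_sup[OF K ne continuous_on_subset[OF contQ]] by blast
  have "quad_form P m g \<le> quad_form P m f * ?N g" for g
  proof (cases "?N g = 0")
    case True
    then have "\<forall>u\<in>P. g u = 0" using assms(1) by (simp add: sum_nonneg_eq_0_iff)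
    then have "quad_form P m g = 0" by (simp add: quad_form_def)
    then show ?thesis using True by simp
  next
    case False
    then have pos: "?N g > 0" by (metis less_eq_real_def sum_nonneg zero_le_power2)
    define s where "s = sqrt (?N g)"
    have s: "s > 0" "s^2 = ?N g" using pos by (auto simp: s_def)
    define h where "h = (\<lambda>u. g u / s)"
    have "?N h = 1"
      unfolding h_def power_divide sum_divide_distrib[symmetric] using s(2) False by simp
    from f(2)[OF norm[OF this]]
    have "quad_form P m h \<le> quad_form P m f"
      by (simp add: quad_form_def)
    moreover have "quad_form P m h = quad_form P m g / s^2"
      unfolding quad_form_def h_def by (simp add: sum_divide_distrib power2_eq_square)
    ultimately show ?thesis unfolding s(2) using pos by (simp only: pos_divide_le_eq)
  qed
  then show ?thesis using f(1) by blast
qed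

lemma eigenfunction_quad_form:
  assumes "eigenfunction P m l f"
  shows "quad_form P m f = l * (\<Sum>u\<in>P. (f u)^2)"
proof -
  have "quad_form P m f = (\<Sum>u\<in>P. f u * (\<Sum>v\<in>P. m u v * f v))"
    unfolding quad_form_def sum_distrib_left by (simp add: mult_ac)
  also have "\<dots> = (\<Sum>u\<in>P. l * (f u)^2)"
    using assms by (intro sum.cong) (auto simp: eigenfunction_def power2_eq_square)
  finally show ?thesis by (simp add: sum_distrib_left)
qed

text \<open>
  The maximum \<open>L\<close> of the Rayleigh quotient is an eigenvalue, and no eigenvalue exceeds it because an
  eigenfunction for \<open>l\<close> has Rayleigh quotient \<open>l\<close>.
\<close>

lemma max_eigenvalue_rayleigh:
  assumes "finite P" "P \<noteq> {}" and sym: "\<And>u v. u \<in> P \<Longrightarrow> v \<in> P \<Longrightarrow> m u v = m v u"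
  shows max_eigenvalue_in: "max_eigenvalue P m \<in> eigenvalues_on P m"
    and quad_form_le_max_eigenvalue: "quad_form P m g \<le> max_eigenvalue P m * (\<Sum>u\<in>P. (g u)^2)"
proof -
  obtain L f where f: "(\<Sum>u\<in>P. (f u)^2) = 1" "quad_form P m f = L"
    and bound: "\<And>g. quad_form P m g \<le> L * (\<Sum>u\<in>P. (g u)^2)"
    using exists_rayleigh_maximizer[OF assms(1,2)] by blast
  have eig: "(\<Sum>v\<in>P. m u v * f v) = L * f u" if "u \<in> P" for u
    using rayleigh_maximizer_is_eigenfunction[OF assms(1) sym bound _ that] f by simp
  have "\<exists>u\<in>P. f u \<noteq> 0"
  proof (rule ccontr)
    assume "\<not> ?thesis"
    then have "(\<Sum>u\<in>P. (f u)^2) = 0" by simp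
    with f(1) show False by simp
  qed
  with eig have L: "L \<in> eigenvalues_on P m"
    unfolding eigenvalues_on_def eigenfunction_def by blast
  have "l \<le> L" if "l \<in> eigenvalues_on P m" for l
  proof -
    from that obtain h where h: "eigenfunction P m l h"
      unfolding eigenvalues_on_def by blast
    then obtain u where u: "u \<in> P" "h u \<noteq> 0" unfolding eigenfunction_def by blast
    have "l * (\<Sum>u\<in>P. (h u)^2) \<le> L * (\<Sum>u\<in>P. (h u)^2)"
      using bound[of h] eigenfunction_quad_form[OF h] by simp
    moreover have "(\<Sum>u\<in>P. (h u)^2) > 0"
      using u assms(1) by (intro sum_pos2[of _ u]) auto
    ultimately show ?thesis by simp
  qed
  then have "max_eigenvalue P m = L"
    unfolding max_eigenvalue_def using L finite_eigenvalues_on[OF assms(1)] by (intro Max_eqI) auto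
  then show "max_eigenvalue P m \<in> eigenvalues_on P m"
    and "quad_form P m g \<le> max_eigenvalue P m * (\<Sum>u\<in>P. (g u)^2)"
    using L bound by auto
qed

lemma top_eigenfunctionI:
  assumes "finite P" "P \<noteq> {}" and sym: "\<And>u v. u \<in> P \<Longrightarrow> v \<in> P \<Longrightarrow> m u v = m v u"
    and eq: "quad_form P m f = max_eigenvalue P m * (\<Sum>u\<in>P. (f u)^2)"
    and "\<exists>u\<in>P. f u \<noteq> 0"
  shows "eigenfunction P m (max_eigenvalue P m) f"
  unfolding eigenfunction_def
proof (intro conjI ballI)
  fix u assume "u \<in> P"
  show "(\<Sum>v\<in>P. m u v * f v) = max_eigenvalue P m * f u"
    by (rule rayleigh_maximizer_is_eigenfunction[OF assms(1) sym _ eq \<open>u \<in> P\<close>])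
      (use quad_form_le_max_eigenvalue[of P m, OF assms(1,2) sym] in auto)
qed (use assms in auto)

text \<open>
  Taking absolute values does not decrease the Rayleigh quotient of a non-negative kernel.
\<close>

lemma nonneg_top_eigenfunction:
  assumes "finite P" "P \<noteq> {}" and sym: "\<And>u v. u \<in> P \<Longrightarrow> v \<in> P \<Longrightarrow> m u v = m v u"
    and nonneg: "\<And>u v. u \<in> P \<Longrightarrow> v \<in> P \<Longrightarrow> m u v \<ge> 0"
  obtains f where "\<And>u. f u \<ge> 0" "eigenfunction P m (max_eigenvalue P m) f"
proof -
  let ?L = "max_eigenvalue P m"
  obtain h where h: "eigenfunction P m ?L h"
    using max_eigenvalue_in[of P m, OF assms(1,2) sym] unfolding eigenvalues_on_def by blast
  let ?f = "\<lambda>u. \<bar>h u\<bar>"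
  have "m u v * h u * h v \<le> m u v * \<bar>h u\<bar> * \<bar>h v\<bar>" if "u \<in> P" "v \<in> P" for u v
    using mult_left_mono[OF abs_ge_self[of "h u * h v"] nonneg[OF that]]
    by (simp add: abs_mult mult.assoc)
  then have "quad_form P m h \<le> quad_form P m ?f"
    unfolding quad_form_def by (intro sum_mono) auto
  then have eq: "quad_form P m ?f = ?L * (\<Sum>u\<in>P. (?f u)^2)"
    using quad_form_le_max_eigenvalue[of P m ?f, OF assms(1,2) sym] eigenfunction_quad_form[OF h]
    by simp
  have "eigenfunction P m ?L ?f"
    using h by (intro top_eigenfunctionI[OF assms(1,2) sym eq]) (auto simp: eigenfunction_def)
  then show ?thesis using that[of ?f] by auto
qed

section \<open>Adjacency and signless Laplacian kernels of graphs\<close>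

text \<open>
  The kernel of \<open>A + c D\<close>: the adjacency matrix for \<open>c = 0\<close> and the signless Laplacian for \<open>c = 1\<close>.
\<close>

definition graph_kernel :: "real \<Rightarrow> 'a rel \<Rightarrow> 'a \<Rightarrow> 'a \<Rightarrow> real" where
  "graph_kernel c E u v = of_bool ((u, v) \<in> E) + (if u = v then c * card (E `` {u}) else 0)"

definition graph_radius :: "real \<Rightarrow> 'a set \<Rightarrow> 'a rel \<Rightarrow> real" where
  "graph_radius c P E = max_eigenvalue P (graph_kernel c E)"

text \<open>
  The edges of a bipartite graph are stored as pairs in one fixed direction across the bipartition;
  the graph itself has the arcs of both directions.
\<close>

definition both_arcs :: "('a \<times> 'a) set \<Rightarrow> 'a rel" where
  "both_arcs B = B \<union> B\<inverse>"

lemma out_degree_with_proj: "out_degree (with_proj G) v = card (parcs G `` {v})"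
proof -
  have "bij_betw snd (out_arcs (with_proj G) v) (parcs G `` {v})"
    by (force simp: bij_betw_def inj_on_def out_arcs_def)
  then show ?thesis unfolding out_degree_def by (rule bij_betw_same_card)
qed

lemma spectral_radius_eq_graph_radius:
  assumes "finite (pverts G)"
  shows "adj_spectral_radius G = graph_radius 0 (pverts G) (parcs G)"
    and "signless_spectral_radius G = graph_radius 1 (pverts G) (parcs G)"
proof -
  let ?vs = "vertex_list G"
  have vs: "distinct ?vs" "set ?vs = pverts G"
    using someI_ex[OF finite_distinct_list[OF assms]] unfolding vertex_list_def
    by (auto simp: conj_commute)
  let ?K = "\<lambda>c. mat (length ?vs) (length ?vs) (\<lambda>(i, j). graph_kernel c (parcs G) (?vs ! i) (?vs ! j))"
  have "adjacency_matrix G = ?K 0"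
    unfolding adjacency_matrix_def Let_def by (rule eq_matI) (auto simp: graph_kernel_def)
  moreover have "adjacency_matrix G + degree_matrix G = ?K 1"
    unfolding adjacency_matrix_def degree_matrix_def Let_def
    by (rule eq_matI)
      (auto simp: graph_kernel_def out_degree_with_proj nth_eq_iff_index_eq[OF vs(1)])
  ultimately show "adj_spectral_radius G = graph_radius 0 (pverts G) (parcs G)"
    and "signless_spectral_radius G = graph_radius 1 (pverts G) (parcs G)"
    unfolding adj_spectral_radius_def signless_spectral_radius_def graph_radius_def
      max_eigenvalue_def by (simp_all add: spectrum_mat_eq_eigenvalues_on[OF vs])
qed

lemma graph_kernel_commute:
  "sym E \<Longrightarrow> graph_kernel c E u v = graph_kernel c E v u"
  unfolding graph_kernel_def by (auto dest: symD)

lemma graph_kernel_row: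
  assumes "finite P" "E \<subseteq> P \<times> P" "u \<in> P"
  shows "(\<Sum>v\<in>P. graph_kernel c E u v * f v) = (\<Sum>v\<in>E `` {u}. f v + c * f u)"
proof -
  have sub: "E `` {u} \<subseteq> P" using assms by auto
  have "(\<Sum>v\<in>P. graph_kernel c E u v * f v) =
      (\<Sum>v\<in>P. (if v \<in> E `` {u} then f v else 0) + (if u = v then c * card (E `` {u}) * f u else 0))"
    unfolding graph_kernel_def by (intro sum.cong) (auto simp: algebra_simps)
  also have "\<dots> = (\<Sum>v\<in>E `` {u}. f v) + c * card (E `` {u}) * f u"
    unfolding sum.distrib sum.inter_restrict[OF assms(1), symmetric] Int_absorb1[OF sub]
    using assms(1,3) by simp
  also have "\<dots> = (\<Sum>v\<in>E `` {u}. f v + c * f u)"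
    by (simp add: sum.distrib)
  finally show ?thesis .
qed

lemma graph_quad_form:
  assumes "finite P" "E \<subseteq> P \<times> P"
  shows "quad_form P (graph_kernel c E) f = (\<Sum>u\<in>P. \<Sum>v\<in>E `` {u}. f u * f v + c * (f u)^2)"
proof -
  have "quad_form P (graph_kernel c E) f = (\<Sum>u\<in>P. f u * (\<Sum>v\<in>P. graph_kernel c E u v * f v))"
    unfolding quad_form_def sum_distrib_left by (simp add: mult_ac)
  also have "\<dots> = (\<Sum>u\<in>P. \<Sum>v\<in>E `` {u}. f u * f v + c * (f u)^2)"
  proof (intro sum.cong refl)
    fix u assume "u \<in> P"
    show "f u * (\<Sum>v\<in>P. graph_kernel c E u v * f v) = (\<Sum>v\<in>E `` {u}. f u * f v + c * (f u)^2)"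
      unfolding graph_kernel_row[OF assms \<open>u \<in> P\<close>] sum_distrib_left
      by (simp add: algebra_simps power2_eq_square)
  qed
  finally show ?thesis .
qed


text \<open>
  The contribution of an edge to the quadratic form; for \<open>c = 1\<close> it is \<open>(f u + f v)\<^sup>2\<close>.
\<close>

definition edge_weight :: "real \<Rightarrow> ('a \<Rightarrow> real) \<Rightarrow> 'a \<times> 'a \<Rightarrow> real" where
  "edge_weight c f = (\<lambda>(u, v). 2 * f u * f v + c * ((f u)^2 + (f v)^2))"

lemma edge_weight_nonneg: "c \<ge> 0 \<Longrightarrow> (\<And>u. f u \<ge> 0) \<Longrightarrow> edge_weight c f e \<ge> 0"
  by (auto simp: edge_weight_def split: prod.split)

lemma bipartite_quad_form:
  assumes fin: "finite U" "finite V" and disj: "U \<inter> V = {}" and B: "B \<subseteq> U \<times> V"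
  shows "quad_form (U \<union> V) (graph_kernel c (both_arcs B)) f = (\<Sum>e\<in>B. edge_weight c f e)"
proof -
  have imU: "both_arcs B `` {u} = B `` {u}" if "u \<in> U" for u
    using that B disj by (auto simp: both_arcs_def)
  have imV: "both_arcs B `` {v} = B\<inverse> `` {v}" if "v \<in> V" for v
    using that B disj by (auto simp: both_arcs_def)
  let ?g = "\<lambda>u v. f u * f v + c * (f u)^2"
  have finB: "finite (B `` {x})" "finite (B\<inverse> `` {y})" for x y
    using B fin by (auto intro: finite_subset[of _ V] finite_subset[of _ U])
  have "quad_form (U \<union> V) (graph_kernel c (both_arcs B)) f = (\<Sum>u\<in>U \<union> V. \<Sum>v\<in>both_arcs B `` {u}. ?g u v)"
    using fin B by (intro graph_quad_form) (auto simp: both_arcs_def)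
  also have "\<dots> = (\<Sum>u\<in>U. \<Sum>v\<in>B `` {u}. ?g u v) + (\<Sum>v\<in>V. \<Sum>u\<in>B\<inverse> `` {v}. ?g v u)"
    using fin disj by (simp add: sum.union_disjoint imU imV)
  also have "(\<Sum>u\<in>U. \<Sum>v\<in>B `` {u}. ?g u v) = (\<Sum>(u, v)\<in>(SIGMA u:U. B `` {u}). ?g u v)"
    using fin finB by (intro sum.Sigma) auto
  also have "(SIGMA u:U. B `` {u}) = B" using B by auto
  also have "(\<Sum>v\<in>V. \<Sum>u\<in>B\<inverse> `` {v}. ?g v u) = (\<Sum>(v, u)\<in>(SIGMA v:V. B\<inverse> `` {v}). ?g v u)"
    using fin finB by (intro sum.Sigma) auto
  also have "(SIGMA v:V. B\<inverse> `` {v}) = prod.swap ` B" using B by force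
  also have "(\<Sum>(v, u)\<in>prod.swap ` B. ?g v u) = (\<Sum>(u, v)\<in>B. ?g v u)"
    by (subst sum.reindex) (auto simp: case_prod_unfold)
  also have "(\<Sum>(u, v)\<in>B. ?g u v) + (\<Sum>(u, v)\<in>B. ?g v u) = (\<Sum>e\<in>B. edge_weight c f e)"
    unfolding sum.distrib[symmetric] edge_weight_def
    by (intro sum.cong) (auto simp: algebra_simps)
  finally show ?thesis .
qed

lemma sym_both_arcs: "sym (both_arcs B)" by (auto simp: both_arcs_def sym_def)

lemma both_arcs_subset: "B \<subseteq> U \<times> V \<Longrightarrow> both_arcs B \<subseteq> (U \<union> V) \<times> (U \<union> V)"
  by (auto simp: both_arcs_def)

lemma bipartite_rayleigh:
  assumes "finite U" "finite V" "U \<noteq> {}" "U \<inter> V = {}" "B \<subseteq> U \<times> V"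
  shows "(\<Sum>e\<in>B. edge_weight c f e) \<le> graph_radius c (U \<union> V) (both_arcs B) * (\<Sum>u\<in>U \<union> V. (f u)^2)"
  unfolding graph_radius_def bipartite_quad_form[OF assms(1,2,4,5), symmetric]
  by (rule quad_form_le_max_eigenvalue) (use assms in \<open>auto intro: graph_kernel_commute sym_both_arcs\<close>)

section \<open>Upper bounds by the number of edges\<close>

lemma card_eq_sum_degrees:
  assumes "finite U" "finite V" "B \<subseteq> U \<times> V"
  shows "card B = (\<Sum>u\<in>U. card (B `` {u}))"
proof -
  have "(SIGMA u:U. B `` {u}) = B" using assms(3) by auto
  moreover have "finite (B `` {u})" for u
    using assms by (auto intro: finite_subset[of _ V])
  then have "card (SIGMA u:U. B `` {u}) = (\<Sum>u\<in>U. card (B `` {u}))"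
    using assms(1) by (intro card_SigmaI) auto
  ultimately show ?thesis by simp
qed

text \<open>
  In a bipartite graph the eigenvector equation on \<open>U\<close> involves only values on \<open>V\<close>, so Cauchy-Schwarz
  gives \<open>\<rho>\<^sup>2 |f\<^sub>U|\<^sup>2 \<le> e |f\<^sub>V|\<^sup>2\<close>, and likewise with \<open>U\<close> and \<open>V\<close> exchanged.  Adding the two bounds
  gives the factor \<open>e\<close>, the number of edges, in place of the \<open>2 e\<close> of the trace of the squared matrix.
\<close>

lemma adjacency_radius_square_le_edges:
  assumes fin: "finite U" "finite V" and "U \<noteq> {}" and disj: "U \<inter> V = {}" and B: "B \<subseteq> U \<times> V"
  shows "(graph_radius 0 (U \<union> V) (both_arcs B))^2 \<le> card B"
proof -
  let ?l = "graph_radius 0 (U \<union> V) (both_arcs B)"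
  have finP: "finite (U \<union> V)" using fin by simp
  have "?l \<in> eigenvalues_on (U \<union> V) (graph_kernel 0 (both_arcs B))"
    unfolding graph_radius_def
    by (rule max_eigenvalue_in) (use assms in \<open>auto intro: graph_kernel_commute sym_both_arcs\<close>)
  then obtain f where "eigenfunction (U \<union> V) (graph_kernel 0 (both_arcs B)) ?l f"
    unfolding eigenvalues_on_def by blast
  then have ne: "\<exists>u\<in>U \<union> V. f u \<noteq> 0"
    and eig: "\<And>u. u \<in> U \<union> V \<Longrightarrow> (\<Sum>v\<in>both_arcs B `` {u}. f v) = ?l * f u"
    using graph_kernel_row[OF finP both_arcs_subset[OF B], of _ 0 f] by (auto simp: eigenfunction_def)
  have finB: "finite (B `` {x})" "finite (B\<inverse> `` {y})" for x y
    using B fin by (auto intro: finite_subset[of _ V] finite_subset[of _ U])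
  define NU where "NU = (\<Sum>u\<in>U. (f u)^2)"
  define NV where "NV = (\<Sum>v\<in>V. (f v)^2)"
  have cs: "(\<Sum>w\<in>S. f w)^2 \<le> card S * (\<Sum>w\<in>W. (f w)^2)" if "S \<subseteq> W" "finite W" for S W
  proof -
    have "(\<Sum>w\<in>S. f w)^2 \<le> card S * (\<Sum>w\<in>S. (f w)^2)"
      using sum_squared_le_sum_of_squares[of f S] by (simp add: mult.commute)
    also have "\<dots> \<le> card S * (\<Sum>w\<in>W. (f w)^2)"
      using that by (intro mult_left_mono sum_mono2) auto
    finally show ?thesis .
  qed
  have cardB: "card B = (\<Sum>u\<in>U. card (B `` {u}))" "card B = (\<Sum>v\<in>V. card (B\<inverse> `` {v}))"
    using card_eq_sum_degrees[OF fin B] card_eq_sum_degrees[OF fin(2,1), of "B\<inverse>"] B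
    by (auto simp: card_inverse)
  have "?l^2 * NU = (\<Sum>u\<in>U. (\<Sum>v\<in>B `` {u}. f v)^2)"
    unfolding NU_def sum_distrib_left
  proof (intro sum.cong refl)
    fix u assume "u \<in> U"
    moreover from this have "both_arcs B `` {u} = B `` {u}" using B disj by (auto simp: both_arcs_def)
    ultimately show "?l^2 * (f u)^2 = (\<Sum>v\<in>B `` {u}. f v)^2"
      using eig[of u] by (simp add: power_mult_distrib)
  qed
  also have "\<dots> \<le> (\<Sum>u\<in>U. card (B `` {u}) * NV)"
    unfolding NV_def using B fin by (intro sum_mono cs) auto
  also have "\<dots> = card B * NV" by (simp add: cardB(1) sum_distrib_right)
  finally have 1: "?l^2 * NU \<le> card B * NV" .
  have "?l^2 * NV = (\<Sum>v\<in>V. (\<Sum>u\<in>B\<inverse> `` {v}. f u)^2)"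
    unfolding NV_def sum_distrib_left
  proof (intro sum.cong refl)
    fix v assume "v \<in> V"
    moreover from this have "both_arcs B `` {v} = B\<inverse> `` {v}" using B disj by (auto simp: both_arcs_def)
    ultimately show "?l^2 * (f v)^2 = (\<Sum>u\<in>B\<inverse> `` {v}. f u)^2"
      using eig[of v] by (simp add: power_mult_distrib)
  qed
  also have "\<dots> \<le> (\<Sum>v\<in>V. card (B\<inverse> `` {v}) * NU)"
    unfolding NU_def using B fin by (intro sum_mono cs) auto
  also have "\<dots> = card B * NU" by (simp add: cardB(2) sum_distrib_right)
  finally have 2: "?l^2 * NV \<le> card B * NU" .
  have "NU + NV = (\<Sum>u\<in>U \<union> V. (f u)^2)"
    unfolding NU_def NV_def using fin disj by (simp add: sum.union_disjoint)
  also obtain z where "z \<in> U \<union> V" "f z \<noteq> 0" using ne by blast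
  then have "(\<Sum>u\<in>U \<union> V. (f u)^2) > 0"
    using finP by (intro sum_pos2[of _ z]) auto
  finally have pos: "NU + NV > 0" .
  have "?l^2 * (NU + NV) \<le> card B * (NU + NV)" using 1 2 by (simp add: distrib_left)
  then show ?thesis using pos by simp
qed

text \<open>
  Write \<open>f = g d\<close> with \<open>d\<close> the degree and consider the eigenvector equation at a vertex \<open>u\<close> where \<open>|g|\<close> is
  largest.  It bounds \<open>\<mu>\<close> by \<open>d u + s / d u\<close>, where \<open>s\<close> is the sum of the degrees of the neighbours
  of \<open>u\<close>.  In a balanced bipartite graph \<open>s\<close> is at most the number \<open>e\<close> of edges and at most \<open>n d u\<close>.  The
  second bound suffices if \<open>d u \<le> e / n\<close>; the first suffices otherwise, because \<open>x + e / x\<close> is convex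
  and takes the value \<open>e / n + n\<close> at both \<open>e / n\<close> and \<open>n\<close>.
\<close>

lemma signless_radius_le_edges:
  assumes fin: "finite U" "finite V" and card: "card U = n" "card V = n" and "n > 0"
    and disj: "U \<inter> V = {}" and B: "B \<subseteq> U \<times> V"
    and deg: "\<And>w. w \<in> U \<union> V \<Longrightarrow> both_arcs B `` {w} \<noteq> {}"
  shows "graph_radius 1 (U \<union> V) (both_arcs B) \<le> card B / n + n"
proof -
  let ?l = "graph_radius 1 (U \<union> V) (both_arcs B)"
  define d where "d w = real (card (both_arcs B `` {w}))" for w
  have finP: "finite (U \<union> V)" using fin by simp
  have UV: "U \<union> V \<noteq> {}" using card \<open>n > 0\<close> by auto
  have "?l \<in> eigenvalues_on (U \<union> V) (graph_kernel 1 (both_arcs B))"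
    unfolding graph_radius_def
    by (rule max_eigenvalue_in) (use fin UV in \<open>auto intro: graph_kernel_commute sym_both_arcs\<close>)
  then obtain f where "eigenfunction (U \<union> V) (graph_kernel 1 (both_arcs B)) ?l f"
    unfolding eigenvalues_on_def by blast
  then have ne: "\<exists>u\<in>U \<union> V. f u \<noteq> 0"
    and eig: "\<And>u. u \<in> U \<union> V \<Longrightarrow> (\<Sum>v\<in>both_arcs B `` {u}. f v + f u) = ?l * f u"
    using graph_kernel_row[OF finP both_arcs_subset[OF B], of _ 1 f] by (auto simp: eigenfunction_def)
  have sub: "both_arcs B `` {w} \<subseteq> U \<union> V" for w using both_arcs_subset[OF B] by auto
  have d_pos: "d w > 0" if "w \<in> U \<union> V" for w
    unfolding d_def using deg[OF that] finite_subset[OF sub finP] by (simp add: card_gt_0_iff)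
  define g where "g w = \<bar>f w\<bar> / d w" for w
  have "Max (g ` (U \<union> V)) \<in> g ` (U \<union> V)" using finP UV by (intro Max_in) auto
  then obtain u where u: "u \<in> U \<union> V" "g u = Max (g ` (U \<union> V))" by (elim imageE) simp
  then have gmax: "g w \<le> g u" if "w \<in> U \<union> V" for w using finP that by simp
  have fg: "\<bar>f w\<bar> = g w * d w" if "w \<in> U \<union> V" for w
    using d_pos[OF that] by (simp add: g_def)
  obtain z where z: "z \<in> U \<union> V" "f z \<noteq> 0" using ne by blast
  then have "g z > 0" using d_pos by (simp add: g_def)
  then have gu: "g u > 0" using gmax[OF z(1)] by simp
  define s where "s = (\<Sum>w\<in>both_arcs B `` {u}. d w)"
  have "?l * \<bar>f u\<bar> \<le> \<bar>?l * f u\<bar>" by (simp add: abs_mult mult_right_mono)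
  also have "\<dots> \<le> (\<Sum>w\<in>both_arcs B `` {u}. \<bar>f w + f u\<bar>)"
    unfolding eig[OF u(1), symmetric] by (rule sum_abs)
  also have "\<dots> \<le> (\<Sum>w\<in>both_arcs B `` {u}. g u * d w + g u * d u)"
  proof (rule sum_mono)
    fix w assume "w \<in> both_arcs B `` {u}"
    then have w: "w \<in> U \<union> V" using sub by blast
    have "\<bar>f w\<bar> \<le> g u * d w"
      unfolding fg[OF w] using gmax[OF w] d_pos[OF w] by (intro mult_right_mono) auto
    then show "\<bar>f w + f u\<bar> \<le> g u * d w + g u * d u"
      using abs_triangle_ineq[of "f w" "f u"] fg[OF u(1)] by simp
  qed
  also have "\<dots> = g u * (s + (d u)^2)"
    unfolding s_def by (simp add: sum.distrib sum_distrib_left d_def power2_eq_square algebra_simps)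
  finally have "g u * (?l * d u) \<le> g u * (s + (d u)^2)" using fg[OF u(1)] by (simp add: mult_ac)
  then have key: "?l * d u \<le> s + (d u)^2" using gu by simp
  have finB: "finite (B `` {x})" "finite (B\<inverse> `` {y})" for x y
    using B fin by (auto intro: finite_subset[of _ V] finite_subset[of _ U])
  have imU: "both_arcs B `` {x} = B `` {x}" if "x \<in> U" for x
    using that B disj by (auto simp: both_arcs_def)
  have imV: "both_arcs B `` {x} = B\<inverse> `` {x}" if "x \<in> V" for x
    using that B disj by (auto simp: both_arcs_def)
  have dn: "d w \<le> n" if "w \<in> U \<union> V" for w
  proof -
    have "card (both_arcs B `` {w}) \<le> n"
    proof (cases "w \<in> U")
      case True
      then show ?thesis using imU[OF True] B card_mono[of V "B `` {w}"] fin card by auto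
    next
      case False
      then have "w \<in> V" using that by simp
      then show ?thesis using imV[of w] B card_mono[of U "B\<inverse> `` {w}"] fin card by auto
    qed
    then show ?thesis by (simp add: d_def)
  qed
  have cardB: "card B = (\<Sum>u\<in>U. card (B `` {u}))" "card B = (\<Sum>v\<in>V. card (B\<inverse> `` {v}))"
    using card_eq_sum_degrees[OF fin B] card_eq_sum_degrees[OF fin(2,1), of "B\<inverse>"] B
    by (auto simp: card_inverse)
  have sumU: "(\<Sum>w\<in>U. d w) = card B" and sumV: "(\<Sum>w\<in>V. d w) = card B"
    unfolding d_def using cardB by (simp_all add: imU imV flip: of_nat_sum)
  have se: "s \<le> card B"
  proof (cases "u \<in> U")
    case True
    then have "both_arcs B `` {u} \<subseteq> V" using imU B by auto
    then have "s \<le> (\<Sum>w\<in>V. d w)" unfolding s_def using fin by (intro sum_mono2) (auto simp: d_def)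
    then show ?thesis using sumV by simp
  next
    case False
    then have "both_arcs B `` {u} \<subseteq> U" using u(1) imV B by auto
    then have "s \<le> (\<Sum>w\<in>U. d w)" unfolding s_def using fin by (intro sum_mono2) (auto simp: d_def)
    then show ?thesis using sumU by simp
  qed
  have sn: "s \<le> d u * n"
  proof -
    have "s \<le> (\<Sum>w\<in>both_arcs B `` {u}. real n)"
      unfolding s_def by (rule sum_mono) (use dn sub in blast)
    then show ?thesis by (simp add: d_def)
  qed
  let ?e = "real (card B)"
  have "?l * d u \<le> (?e / n + n) * d u"
  proof (cases "d u * n \<le> ?e")
    case True
    then have "d u \<le> ?e / n" using \<open>n > 0\<close> by (simp add: field_simps)
    then have "d u * d u \<le> ?e / n * d u" using d_pos[OF u(1)] by (intro mult_right_mono) auto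
    then show ?thesis using key sn by (simp add: power2_eq_square algebra_simps)
  next
    case False
    then have "d u \<ge> ?e / n" using \<open>n > 0\<close> by (simp add: field_simps)
    then have "(d u - n) * (d u - ?e / n) \<le> 0"
      using dn[OF u(1)] by (intro mult_nonpos_nonneg) auto
    moreover have "?e = ?e / n * n" using \<open>n > 0\<close> by simp
    moreover have "(d u - n) * (d u - t) = (d u)^2 + t * n - (t + n) * d u" for t
      by (simp add: power2_eq_square algebra_simps)
    ultimately have "(d u)^2 + ?e \<le> (?e / n + n) * d u" by (smt (verit))
    then show ?thesis using key se by simp
  qed
  then show ?thesis using d_pos[OF u(1)] by simp
qed

section \<open>Strict monotonicity of the largest eigenvalue\<close>

text \<open>
  The Perron-Frobenius argument.  If the radii were equal, \<open>f\<close> would maximize the Rayleigh quotient of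
  \<open>E'\<close> as well and would hence be an eigenfunction of both graphs for the same eigenvalue.  As an
  eigenfunction of the connected graph \<open>E'\<close> it has no zeros, so the row of \<open>z\<close>, which gains an
  entry, cannot have the same sum in both graphs.  The graph \<open>E'\<close> need not contain \<open>E\<close>, so the lemma
  also covers exchanges of edges.
\<close>

lemma graph_radius_less:
  assumes P: "finite P" "P \<noteq> {}" and E: "E \<subseteq> P \<times> P" "E' \<subseteq> P \<times> P" "sym E'" and "c \<ge> 0"
    and f: "\<And>u. f u \<ge> 0" "eigenfunction P (graph_kernel c E) (graph_radius c P E) f"
    and le: "quad_form P (graph_kernel c E) f \<le> quad_form P (graph_kernel c E') f"
    and z: "z \<in> P" "E `` {z} \<subset> E' `` {z}"
    and connected: "\<And>Z. Z \<subseteq> P \<Longrightarrow> Z \<noteq> {} \<Longrightarrow> E' `` Z \<subseteq> Z \<Longrightarrow> Z = P"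
  shows "graph_radius c P E < graph_radius c P E'"
proof (rule ccontr)
  let ?r = "graph_radius c P E" and ?r' = "graph_radius c P E'" and ?N = "\<Sum>u\<in>P. (f u)^2"
  assume "\<not> ?r < ?r'"
  then have ge: "?r' \<le> ?r" by simp
  obtain x where x: "x \<in> P" "f x \<noteq> 0" using f(2) by (auto simp: eigenfunction_def)
  then have N: "?N > 0" using P by (intro sum_pos2[of _ x]) auto
  have symE': "\<And>u v. graph_kernel c E' u v = graph_kernel c E' v u"
    using graph_kernel_commute[OF E(3)] .
  have "quad_form P (graph_kernel c E') f \<le> ?r' * ?N"
    unfolding graph_radius_def by (rule quad_form_le_max_eigenvalue[OF P]) (rule symE')
  moreover have "quad_form P (graph_kernel c E) f = ?r * ?N"
    using eigenfunction_quad_form[OF f(2)] .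
  moreover have "?r' * ?N \<le> ?r * ?N" using ge N by (intro mult_right_mono) auto
  ultimately have q: "quad_form P (graph_kernel c E') f = ?r' * ?N" and "?r' * ?N = ?r * ?N"
    using le by linarith+
  then have req: "?r' = ?r" using N by simp
  have eig': "eigenfunction P (graph_kernel c E') ?r' f"
    using top_eigenfunctionI[OF P, of "graph_kernel c E'" f] symE' q x unfolding graph_radius_def by blast
  have row: "(\<Sum>v\<in>E `` {u}. f v + c * f u) = ?r * f u"
    and row': "(\<Sum>v\<in>E' `` {u}. f v + c * f u) = ?r * f u" if "u \<in> P" for u
    using f(2) eig' that graph_kernel_row[OF P(1) E(1) that, of c f]
      graph_kernel_row[OF P(1) E(2) that, of c f] by (auto simp: eigenfunction_def req)
  have fin: "finite (E' `` {u})" for u using E(2) P(1) by (auto intro: finite_subset[of _ P])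
  have pos: "f u > 0" if "u \<in> P" for u
  proof (rule ccontr)
    let ?Z = "{v \<in> P. f v = 0}"
    assume "\<not> f u > 0"
    then have "?Z \<noteq> {}" using f(1)[of u] that by auto
    moreover have "E' `` ?Z \<subseteq> ?Z"
    proof
      fix w assume "w \<in> E' `` ?Z"
      then obtain v where v: "v \<in> P" "f v = 0" "w \<in> E' `` {v}" by auto
      then have "(\<Sum>v\<in>E' `` {v}. f v) = 0" using row'[of v] by simp
      then have "f w = 0" using v(3) fin f(1) by (simp add: sum_nonneg_eq_0_iff)
      then show "w \<in> ?Z" using v E(2) by auto
    qed
    ultimately have "?Z = P" by (intro connected) auto
    then show False using x by auto
  qed
  have "(\<Sum>v\<in>E `` {z}. f v + c * f z) < (\<Sum>v\<in>E' `` {z}. f v + c * f z)"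
  proof -
    obtain w where w: "w \<in> E' `` {z} - E `` {z}" using z(2) by blast
    then have "f w > 0" using pos E(2) by blast
    then have "f w + c * f z > 0" using f(1)[of z] \<open>c \<ge> 0\<close> by (intro add_pos_nonneg) auto
    then show ?thesis
      using z(2) fin w f(1) \<open>c \<ge> 0\<close> by (intro sum_strict_mono2[of _ _ w]) auto
  qed
  then show False using row[OF z(1)] row'[OF z(1)] by simp
qed

section \<open>Hamilton cycles in balanced bipartite graphs\<close>

text \<open>
  A spanning cycle \<open>a 0, c 0, a 1, c 1, \<dots>\<close> that alternates between the two sides.
\<close>

definition ham_bip :: "'a set \<Rightarrow> 'b set \<Rightarrow> ('a \<times> 'b) set \<Rightarrow> bool" where
  "ham_bip U V B \<longleftrightarrow> (\<exists>a c. bij_betw a {..<card U} U \<and> bij_betw c {..<card U} V \<and>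
     (\<forall>i<card U. (a i, c i) \<in> B \<and> (a (Suc i mod card U), c i) \<in> B))"

lemma bij_betw_if_involution:
  assumes "\<And>j. j \<in> A \<Longrightarrow> h j \<in> A \<and> h (h j) = j"
  shows "bij_betw h A A"
  by (rule bij_betwI[where g = h]) (use assms in auto)

lemma bij_betw_add_mod: "bij_betw (\<lambda>j. (j + r) mod m) {..<m} {..<m::nat}"
proof (cases "m = 0")
  case False
  have "inj_on (\<lambda>j. (j + r) mod m) {..<m}"
  proof (rule inj_onI)
    fix i j assume ij: "i \<in> {..<m}" "j \<in> {..<m}" "(i + r) mod m = (j + r) mod m"
    then have "[i + r = j + r] (mod m)" by (simp add: cong_def)
    then have "[i = j] (mod m)" by (simp add: cong_add_rcancel_nat)
    then show "i = j" using ij by (simp add: cong_def)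
  qed
  moreover have "(\<lambda>j. (j + r) mod m) ` {..<m} \<subseteq> {..<m}" using False by auto
  ultimately show ?thesis
    by (metis bij_betw_def endo_inj_surj finite_lessThan)
qed (simp add: bij_betw_def)

lemma bij_betw_diff_mod:
  assumes "r < m"
  shows "bij_betw (\<lambda>j. (r + m - j) mod m) {..<m} {..<m::nat}"
proof (rule bij_betw_if_involution)
  fix j assume "j \<in> {..<m}"
  then have j: "j < m" by simp
  have *: "(r + m - i) mod m = (if i \<le> r then r - i else r + m - i)" if "i < m" for i
    using that assms by (auto simp: mod_if not_le)
  show "(r + m - j) mod m \<in> {..<m} \<and> (r + m - (r + m - j) mod m) mod m = j"
    using j assms by (auto simp: *)
qed

text \<open>
  Ore's crossing argument for a spanning path \<open>a 0, c 0, \<dots>, a (m - 1), c (m - 1)\<close>: go from \<open>a 0\<close> to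
  \<open>a i\<close>, jump to the last vertex, run back to \<open>c i\<close> and return to \<open>a 0\<close>.
\<close>

lemma ham_bip_if_crossing:
  assumes a: "bij_betw a {..<m} U" and c: "bij_betw c {..<m} V" and m: "m = card U"
    and path: "\<And>j. j < m \<Longrightarrow> (a j, c j) \<in> B" "\<And>j. Suc j < m \<Longrightarrow> (a (Suc j), c j) \<in> B"
    and i: "i < m" "(a 0, c i) \<in> B" "(a i, c (m - 1)) \<in> B"
  shows "ham_bip U V B"
proof -
  define p where "p j = (if j \<le> i then j else m + i - j)" for j
  define s where "s j = (if j < i then j else m - 1 + i - j)" for j
  have "bij_betw p {..<m} {..<m}" "bij_betw s {..<m} {..<m}"
    using i(1) by (auto intro!: bij_betw_if_involution simp: p_def s_def)
  then have "bij_betw (a \<circ> p) {..<m} U" "bij_betw (c \<circ> s) {..<m} V"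
    using a c by (auto intro: bij_betw_trans)
  moreover have "(a (p j), c (s j)) \<in> B" if "j < m" for j
  proof -
    consider "j < i" | "j = i" | "j > i" by linarith
    then show ?thesis
    proof cases
      case 3
      then have "p j = Suc (s j)" "Suc (s j) < m" using that i(1) by (auto simp: p_def s_def)
      then show ?thesis using path(2) by simp
    qed (use that path i in \<open>auto simp: p_def s_def\<close>)
  qed
  moreover have "(a (p (Suc j mod m)), c (s j)) \<in> B" if "j < m" for j
  proof -
    consider "Suc j = m" | "j < i" "Suc j < m" | "j \<ge> i" "Suc j < m" using \<open>j < m\<close> by linarith
    then show ?thesis
    proof cases
      case 1
      then have "p (Suc j mod m) = 0" "s j = i" using i(1) by (auto simp: p_def s_def)
      then show ?thesis using i(2) by simp
    next
      case 2
      then show ?thesis using path(2)[of j] by (simp add: p_def s_def)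
    next
      case 3
      then have "p (Suc j mod m) = s j" "s j < m" using i(1) by (auto simp: p_def s_def)
      then show ?thesis using path(1) by simp
    qed
  qed
  ultimately show ?thesis
    unfolding ham_bip_def m[symmetric] by (intro exI[of _ "a \<circ> p"] exI[of _ "c \<circ> s"]) auto
qed

text \<open>
  A Hamilton cycle through \<open>uv\<close> is rotated until \<open>uv\<close> is the edge that closes it; if the cycle runs
  through the edge from \<open>u\<close> to \<open>v\<close>, it has to be reversed as well.
\<close>

lemma ham_path_if_ham_bip_insert:
  assumes ham: "ham_bip U V (insert (u, v) B)" and "\<not> ham_bip U V B"
  obtains a c where "bij_betw a {..<card U} U" "bij_betw c {..<card U} V"
    "a 0 = u" "c (card U - 1) = v"
    "\<And>j. j < card U \<Longrightarrow> (a j, c j) \<in> insert (u, v) B"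
    "\<And>j. Suc j < card U \<Longrightarrow> (a (Suc j), c j) \<in> insert (u, v) B"
proof -
  define m where "m = card U"
  obtain a c where a: "bij_betw a {..<m} U" and c: "bij_betw c {..<m} V"
    and ac: "\<And>i. i < m \<Longrightarrow> (a i, c i) \<in> insert (u, v) B"
      "\<And>i. i < m \<Longrightarrow> (a (Suc i mod m), c i) \<in> insert (u, v) B"
    using ham unfolding ham_bip_def m_def by blast
  have "\<not> (\<forall>i<m. (a i, c i) \<in> B \<and> (a (Suc i mod m), c i) \<in> B)"
    using assms(2) a c unfolding ham_bip_def m_def by blast
  then obtain i where i: "i < m" "(a i, c i) \<notin> B \<or> (a (Suc i mod m), c i) \<notin> B" by blast
  then consider "a i = u" "c i = v" | "a (Suc i mod m) = u" "c i = v" using ac by blast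
  then show ?thesis
  proof cases
    case 1
    define p where "p j = (i + m - j) mod m" for j
    have p: "p j = (if j \<le> i then i - j else i + m - j)" if "j < m" for j
      using that i(1) by (auto simp: p_def mod_if)
    \<comment> \<open>the predecessor of \<open>i\<close> modulo \<open>m\<close>; the reversed cycle is \<open>a i, c i', a i', \<dots>, c i\<close>\<close>
    define i' where "i' = (if i = 0 then m - 1 else i - 1)"
    have i': "i' < m" using i(1) by (auto simp: i'_def)
    define s where "s j = (i' + m - j) mod m" for j
    have s: "s j = (if j \<le> i' then i' - j else i' + m - j)" if "j < m" for j
      using that i' by (auto simp: s_def mod_if)
    have "bij_betw p {..<m} {..<m}" "bij_betw s {..<m} {..<m}"
      unfolding p_def s_def using bij_betw_diff_mod i(1) i' by auto
    then have bij: "bij_betw (a \<circ> p) {..<m} U" "bij_betw (c \<circ> s) {..<m} V"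
      using a c by (auto intro: bij_betw_trans)
    have "p 0 = i" "s (m - 1) = i" using i(1) by (auto simp: p s i'_def)
    moreover have "p j = Suc (s j) mod m" "s j < m" if "j < m" for j
    proof -
      have "j = i \<Longrightarrow> p j = 0 \<and> s j = m - 1" and "j \<noteq> i \<Longrightarrow> p j = Suc (s j) \<and> Suc (s j) < m"
        using that i(1) by (auto simp: p s i'_def)
      then show "p j = Suc (s j) mod m" "s j < m" using that by (cases "j = i"; auto)+
    qed
    moreover have "p (Suc j) = s j" if "Suc j < m" for j
      using that i(1) by (auto simp: p s i'_def)
    ultimately show ?thesis
      using that[of "a \<circ> p" "c \<circ> s"] bij ac 1 i(1) unfolding m_def[symmetric] by auto
  next
    case 2
    define p where "p j = (j + Suc i) mod m" for j
    have "bij_betw p {..<m} {..<m}"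
      unfolding p_def by (rule bij_betw_add_mod)
    then have bij: "bij_betw (a \<circ> p) {..<m} U" "bij_betw (c \<circ> p) {..<m} V"
      using a c by (auto intro: bij_betw_trans)
    have "p 0 = Suc i mod m" "p (m - 1) = i" using i(1) by (auto simp: p_def mod_if)
    moreover have "p j < m" for j using i(1) by (auto simp: p_def)
    moreover have "p (Suc j) = Suc (p j) mod m" for j by (simp add: p_def mod_Suc_eq)
    ultimately show ?thesis
      using that[of "a \<circ> p" "c \<circ> p"] bij ac 2 i(1) unfolding m_def[symmetric] by auto
  qed
qed

text \<open>
  The bipartite form of Ore's degree condition.  The positions at which \<open>u\<close> has a neighbour and those
  at which \<open>v\<close> has one are subsets of a set of \<open>card U\<close> positions; a common position would allow
  the crossing argument.
\<close>

lemma ham_bip_insert_degree_sum: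
  assumes fin: "finite U" "finite V" and "card V = card U" and B: "B \<subseteq> U \<times> V"
    and ham: "ham_bip U V (insert (u, v) B)" and nham: "\<not> ham_bip U V B"
    and uv: "u \<in> U" "v \<in> V" "(u, v) \<notin> B"
  shows "card (B `` {u}) + card (B\<inverse> `` {v}) \<le> card U"
proof (rule ccontr)
  let ?m = "card U"
  assume "\<not> ?thesis"
  then have gt: "card (B `` {u}) + card (B\<inverse> `` {v}) > ?m" by simp
  obtain a c where a: "bij_betw a {..<?m} U" and c: "bij_betw c {..<?m} V"
    and ends: "a 0 = u" "c (?m - 1) = v"
    and path: "\<And>j. j < ?m \<Longrightarrow> (a j, c j) \<in> insert (u, v) B"
      "\<And>j. Suc j < ?m \<Longrightarrow> (a (Suc j), c j) \<in> insert (u, v) B"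
    using ham_path_if_ham_bip_insert[OF ham nham] by blast
  define I where "I = {i. i < ?m \<and> (u, c i) \<in> B}"
  define J where "J = {i. i < ?m \<and> (a i, v) \<in> B}"
  have "bij_betw c I (B `` {u})"
  proof (rule bij_betw_subset[OF c, THEN bij_betw_cong[THEN iffD1, rotated]])
    show "I \<subseteq> {..<?m}" by (auto simp: I_def)
    show "c ` I = B `` {u}"
      using B c by (auto simp: I_def bij_betw_def image_iff set_eq_iff)
        (metis SigmaD2 image_iff lessThan_iff subset_eq)
  qed auto
  then have cI: "card I = card (B `` {u})" by (rule bij_betw_same_card)
  have "bij_betw a J (B\<inverse> `` {v})"
  proof (rule bij_betw_subset[OF a, THEN bij_betw_cong[THEN iffD1, rotated]])
    show "J \<subseteq> {..<?m}" by (auto simp: J_def)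
    show "a ` J = B\<inverse> `` {v}"
      using B a by (auto simp: J_def bij_betw_def image_iff set_eq_iff)
        (metis SigmaD1 image_iff lessThan_iff subset_eq)
  qed auto
  then have cJ: "card J = card (B\<inverse> `` {v})" by (rule bij_betw_same_card)
  have "I \<inter> J \<noteq> {}"
  proof
    assume "I \<inter> J = {}"
    then have "card I + card J = card (I \<union> J)"
      by (subst card_Un_disjoint) (auto simp: I_def J_def)
    also have "\<dots> \<le> card {..<?m}" by (rule card_mono) (auto simp: I_def J_def)
    finally show False using gt cI cJ by simp
  qed
  then obtain i where i: "i < ?m" "(u, c i) \<in> B" "(a i, v) \<in> B" by (auto simp: I_def J_def)
  have ainj: "a j = u \<longleftrightarrow> j = 0" if "j < ?m" for j
    using a that ends(1) unfolding bij_betw_def inj_on_def by (metis lessThan_iff gr0I not_less_zero)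
  have cinj: "c j = v \<longleftrightarrow> j = ?m - 1" if "j < ?m" for j
  proof -
    have "?m - 1 \<in> {..<?m}" "j \<in> {..<?m}" using that by auto
    then show ?thesis using c ends(2) unfolding bij_betw_def inj_on_def by blast
  qed
  have "?m > 1"
  proof (rule ccontr)
    assume "\<not> ?m > 1"
    then have "i = 0" using i(1) by simp
    then show False using i(3) ends uv(3) by simp
  qed
  have "ham_bip U V B"
  proof (rule ham_bip_if_crossing[OF a c refl])
    show "(a j, c j) \<in> B" if "j < ?m" for j
      using path(1)[OF that] ainj[OF that] cinj[OF that] \<open>?m > 1\<close> by auto
    show "(a (Suc j), c j) \<in> B" if "Suc j < ?m" for j
      using path(2)[OF that] ainj[OF that] by auto
  qed (use i ends in auto)
  then show False using nham by simp
qed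

lemma ham_bip_complete:
  assumes "finite U" "finite V" "card V = card U"
  shows "ham_bip U V (U \<times> V)"
proof -
  obtain a c where a: "bij_betw a {..<card U} U" and c: "bij_betw c {..<card U} V"
    using ex_bij_betw_nat_finite assms by (metis atLeast0LessThan)
  have "a i \<in> U" "c i \<in> V" "a (Suc i mod card U) \<in> U" if "i < card U" for i
    using a c that by (auto simp: bij_betw_def)
  then show ?thesis using a c unfolding ham_bip_def by blast
qed

lemma maximal_nonhamiltonian_supergraph:
  assumes fin: "finite U" "finite V" and card: "card V = card U" and "B \<subseteq> U \<times> V" "\<not> ham_bip U V B"
  obtains C where "B \<subseteq> C" "C \<subset> U \<times> V"
    "\<And>u v. u \<in> U \<Longrightarrow> v \<in> V \<Longrightarrow> (u, v) \<notin> C \<Longrightarrow>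
       card (C `` {u}) + card (C\<inverse> `` {v}) \<le> card U"
proof -
  define S where "S = {C. B \<subseteq> C \<and> C \<subseteq> U \<times> V \<and> \<not> ham_bip U V C}"
  have "finite S" unfolding S_def
    by (rule finite_subset[of _ "Pow (U \<times> V)"]) (use fin in auto)
  moreover have "S \<noteq> {}" unfolding S_def using assms by blast
  ultimately have "\<exists>C\<in>S. \<forall>D\<in>S. C \<subseteq> D \<longrightarrow> C = D" by (rule finite_has_maximal)
  then obtain C where C: "C \<in> S" and max: "\<And>D. D \<in> S \<Longrightarrow> C \<subseteq> D \<Longrightarrow> C = D"
    by blast
  have CB: "B \<subseteq> C" "C \<subseteq> U \<times> V" "\<not> ham_bip U V C" using C unfolding S_def by auto
  have "C \<noteq> U \<times> V" using CB(3) ham_bip_complete[OF fin card] by auto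
  moreover have "card (C `` {u}) + card (C\<inverse> `` {v}) \<le> card U"
    if uv: "u \<in> U" "v \<in> V" "(u, v) \<notin> C" for u v
  proof (rule ham_bip_insert_degree_sum[OF fin card CB(2) _ CB(3) uv])
    show "ham_bip U V (insert (u, v) C)"
    proof (rule ccontr)
      assume "\<not> ham_bip U V (insert (u, v) C)"
      then have "insert (u, v) C \<in> S" unfolding S_def using CB uv by auto
      from max[OF this] uv(3) show False by auto
    qed
  qed
  ultimately show ?thesis using that[of C] CB by blast
qed

lemma pre_digraph_cas_upt:
  assumes "tail H = fst" "head H = snd"
  shows "pre_digraph.cas H (w i) (map (\<lambda>j. (w j, w (Suc j))) [i..<i + n]) (w (i + n))"
    and "pre_digraph.awalk_verts H (w i) (map (\<lambda>j. (w j, w (Suc j))) [i..<i + n]) = map w [i..<Suc (i + n)]"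
proof -
  have "pre_digraph.cas H (w i) (map (\<lambda>j. (w j, w (Suc j))) [i..<i + n]) (w (i + n)) \<and>
    pre_digraph.awalk_verts H (w i) (map (\<lambda>j. (w j, w (Suc j))) [i..<i + n]) = map w [i..<Suc (i + n)]"
  proof (induction n arbitrary: i)
    case 0
    then show ?case
      by (simp add: pre_digraph.cas.simps pre_digraph.awalk_verts.simps)
  next
    case (Suc n)
    have 1: "[i..<i + Suc n] = i # [Suc i..<Suc i + n]" by (simp add: upt_conv_Cons)
    have 2: "[i..<Suc (i + Suc n)] = i # [Suc i..<Suc (Suc i + n)]"
      using upt_conv_Cons[of i "Suc (i + Suc n)"] by simp
    show ?case
      using Suc.IH[of "Suc i"] assms unfolding 1 2
      by (simp add: pre_digraph.cas.simps pre_digraph.awalk_verts.simps del: upt_Suc)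
  qed
  then show "pre_digraph.cas H (w i) (map (\<lambda>j. (w j, w (Suc j))) [i..<i + n]) (w (i + n))"
    and "pre_digraph.awalk_verts H (w i) (map (\<lambda>j. (w j, w (Suc j))) [i..<i + n]) = map w [i..<Suc (i + n)]"
    by auto
qed

text \<open>
  The alternating sequence is turned into a closed walk by reading it as one function \<open>w\<close> of period
  \<open>2 * card U\<close>.
\<close>

lemma has_spanning_cycle_if_ham_bip:
  assumes ham: "ham_bip U V B" and sym: "B \<union> B\<inverse> \<subseteq> parcs G" and disj: "U \<inter> V = {}"
    and UV: "U \<union> V \<subseteq> pverts G" and m: "card U \<ge> 2"
  shows "has_spanning_cycle (with_proj G \<restriction> (U \<union> V))"
proof -
  let ?m = "card U" and ?H = "with_proj G \<restriction> (U \<union> V)"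
  obtain a c where a: "bij_betw a {..<?m} U" and c: "bij_betw c {..<?m} V"
    and ac: "\<And>i. i < ?m \<Longrightarrow> (a i, c i) \<in> B" "\<And>i. i < ?m \<Longrightarrow> (a (Suc i mod ?m), c i) \<in> B"
    using ham unfolding ham_bip_def by blast
  define x where "x j = (if even j then a (j div 2) else c (j div 2))" for j :: nat
  define w where "w j = x (j mod (2 * ?m))" for j
  have aU: "a i \<in> U" and cV: "c i \<in> V" if "i < ?m" for i
    using that a c by (auto simp: bij_betw_def)
  have xUV: "x j \<in> U \<union> V" if "j < 2 * ?m" for j
    using that aU cV by (auto simp: x_def)
  have x_inj: "inj_on x {..<2 * ?m}"
  proof (rule inj_onI)
    fix i j assume ij: "i \<in> {..<2 * ?m}" "j \<in> {..<2 * ?m}" "x i = x j"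
    then have lt: "i div 2 < ?m" "j div 2 < ?m" by auto
    have "even i \<longleftrightarrow> even j"
      using ij(3) aU[OF lt(1)] aU[OF lt(2)] cV[OF lt(1)] cV[OF lt(2)] disj
      by (auto simp: x_def split: if_splits)
    moreover have "i div 2 = j div 2"
      using ij(3) calculation a c lt unfolding x_def bij_betw_def
      by (auto simp: inj_on_eq_iff split: if_splits)
    ultimately show "i = j" by (metis dvd_mult_div_cancel odd_two_times_div_two_succ)
  qed
  have x_surj: "x ` {..<2 * ?m} = U \<union> V"
  proof
    show "x ` {..<2 * ?m} \<subseteq> U \<union> V" using xUV by auto
    show "U \<union> V \<subseteq> x ` {..<2 * ?m}"
    proof
      fix z assume "z \<in> U \<union> V"
      then consider i where "i < ?m" "z = a i" | i where "i < ?m" "z = c i"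
        using a c by (auto simp: bij_betw_def)
      then show "z \<in> x ` {..<2 * ?m}"
      proof cases
        case 1
        then show ?thesis by (intro image_eqI[of _ _ "2 * i"]) (auto simp: x_def)
      next
        case 2
        then show ?thesis by (intro image_eqI[of _ _ "2 * i + 1"]) (auto simp: x_def)
      qed
    qed
  qed
  have w_arc: "(w j, w (Suc j)) \<in> parcs G" for j
  proof -
    let ?r = "j mod (2 * ?m)"
    have r: "?r < 2 * ?m" using m by simp
    have suc: "Suc j mod (2 * ?m) = (if Suc ?r = 2 * ?m then 0 else Suc ?r)"
      by (rule mod_Suc)
    show ?thesis
    proof (cases "even ?r")
      case True
      then obtain i where i: "?r = 2 * i" by (elim evenE)
      then have "i < ?m" "w j = a i" "w (Suc j) = c i"
        using r suc by (auto simp: w_def x_def)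
      then show ?thesis using ac(1) sym by auto
    next
      case False
      then obtain i where i: "?r = 2 * i + 1" by (elim oddE)
      then have "i < ?m" "w j = c i" "w (Suc j) = a (Suc i mod ?m)"
        using r suc by (auto simp: w_def x_def mod_Suc)
      then show ?thesis using ac(2) sym by auto
    qed
  qed
  have wUV: "w j \<in> U \<union> V" for j
    unfolding w_def using m by (intro xUV) simp
  define p where "p = map (\<lambda>j. (w j, w (Suc j))) [0..<0 + 2 * ?m]"
  have "w (0 + 2 * ?m) = w 0" by (simp add: w_def)
  then have cas: "pre_digraph.cas ?H (w 0) p (w 0)"
    using pre_digraph_cas_upt(1)[of ?H w 0 "2 * ?m"] by (simp add: p_def)
  have "inj_on w {1..<Suc (2 * ?m)}"
  proof (rule inj_onI)
    fix i j assume ij: "i \<in> {1..<Suc (2 * ?m)}" "j \<in> {1..<Suc (2 * ?m)}" "w i = w j"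
    then have "i mod (2 * ?m) = j mod (2 * ?m)"
      using x_inj m by (auto simp: w_def inj_on_eq_iff)
    then show "i = j" using ij(1,2) by (auto simp: mod_if split: if_splits)
  qed
  moreover have "tl (pre_digraph.awalk_verts ?H (w 0) p) = map w [1..<Suc (2 * ?m)]"
    using pre_digraph_cas_upt(2)[of ?H w 0 "2 * ?m"] upt_conv_Cons[of 0 "Suc (2 * ?m)"]
    by (simp add: p_def del: upt_Suc)
  ultimately have dist: "distinct (tl (pre_digraph.awalk_verts ?H (w 0) p))"
    by (simp add: distinct_map del: upt_Suc)
  have "set p \<subseteq> arcs ?H"
  proof
    fix e assume "e \<in> set p"
    then obtain j where "e = (w j, w (Suc j))" unfolding p_def by auto
    then show "e \<in> arcs ?H" using w_arc[of j] wUV[of j] wUV[of "Suc j"] by simp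
  qed
  then have "pre_digraph.awalk ?H (w 0) p (w 0)"
    using cas wUV UV unfolding pre_digraph.awalk_def by auto
  then have "pre_digraph.cycle ?H p"
    unfolding pre_digraph.cycle_def using dist m by (auto simp: p_def)
  moreover have "w ` {0..<2 * ?m} = x ` {..<2 * ?m}"
    by (intro image_cong) (auto simp: w_def)
  then have "tail ?H ` set p = verts ?H"
    using UV unfolding p_def by (simp add: image_image x_surj)
  ultimately show ?thesis
    unfolding has_spanning_cycle_def using m by (intro exI[of _ p]) (auto simp: p_def)
qed

section \<open>Sparse blocks in dense non-Hamiltonian graphs\<close>

text \<open>
  The set \<open>T\<close> consists of the vertices that are not adjacent to \<open>v\<close>.  They have degree \<open>b\<close>, so more than
  \<open>b\<close> of them would cause too many non-edges; so would, in addition to the non-edges at \<open>T\<close>, a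
  single non-adjacent pair \<open>x, y\<close> with \<open>x\<close> outside \<open>T\<close>, since its degree sum is at most \<open>m\<close>.  A
  neighbour \<open>w\<close> of a vertex of \<open>T\<close> therefore has degree at least \<open>m - b + 1\<close>, which forces it to be a
  neighbour of \<open>u\<close>, too.
\<close>

lemma sparse_block_if_degree_eq:
  fixes B :: "('a \<times> 'b) set"
  assumes fin: "finite U" "finite V" and card: "card U = m" "card V = m" and B: "B \<subseteq> U \<times> V"
    and ore: "\<And>u v. u \<in> U \<Longrightarrow> v \<in> V \<Longrightarrow> (u, v) \<notin> B \<Longrightarrow> card (B `` {u}) + card (B\<inverse> `` {v}) \<le> m"
    and few: "card (U \<times> V - B) < (b + 1) * (m - b - 1)"
    and deg: "\<And>u. u \<in> U \<Longrightarrow> b \<le> card (B `` {u})"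
    and uv: "u \<in> U" "v \<in> V" "(u, v) \<notin> B" "card (B `` {u}) = b"
    and max: "\<And>u'. u' \<in> U \<Longrightarrow> (u', v) \<notin> B \<Longrightarrow> card (B `` {u'}) \<le> b"
  shows "\<exists>T\<subseteq>U. \<exists>N\<subseteq>V. card T = b \<and> card N = b \<and> B `` T \<subseteq> N"
proof -
  have finB: "finite (B `` {x})" "finite (B\<inverse> `` {y})" for x y
    using B fin by (auto intro: finite_subset[of _ V] finite_subset[of _ U])
  have sub: "B `` {x} \<subseteq> V" "B\<inverse> `` {y} \<subseteq> U" for x y using B by auto
  have finE: "finite (U \<times> V - B)" using fin by simp
  have mb: "m > b + 1" using few by (cases "m \<le> b + 1") auto
  define A where "A = U - B\<inverse> `` {v}"
  have A: "A \<subseteq> U" "finite A" using fin by (auto simp: A_def)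
  have dA: "card (B `` {x}) = b" if "x \<in> A" for x
    using that max[of x] deg[of x] by (auto simp: A_def)
  have rowA: "card (V - B `` {x}) = m - b" if "x \<in> A" for x
    using that sub finB by (simp add: card_Diff_subset card dA)
  let ?EA = "SIGMA x:A. V - B `` {x}"
  have EA: "card ?EA = card A * (m - b)"
    using A fin by (subst card_SigmaI) (auto simp: rowA)
  have EAsub: "?EA \<subseteq> U \<times> V - B" using A by auto
  have cA: "card A = m - card (B\<inverse> `` {v})"
    unfolding A_def using sub finB by (simp add: card_Diff_subset card)
  then have cA_ge: "card A \<ge> b" using ore[OF uv(1-3)] uv(4) by simp
  moreover have "card A < b + 1"
  proof (rule ccontr)
    assume "\<not> card A < b + 1"
    then have "(b + 1) * (m - b) \<le> card ?EA" unfolding EA by (intro mult_right_mono) auto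
    also have "\<dots> \<le> card (U \<times> V - B)" by (rule card_mono[OF finE EAsub])
    also have "\<dots> < (b + 1) * (m - b - 1)" by (rule few)
    also have "\<dots> \<le> (b + 1) * (m - b)" by (intro mult_left_mono) auto
    finally show False by simp
  qed
  ultimately have cA: "card A = b" by simp
  have full: "(x, y) \<in> B" if xy: "x \<in> U - A" "y \<in> V" for x y
  proof (rule ccontr)
    assume nB: "(x, y) \<notin> B"
    \<comment> \<open>the non-edges at \<open>x\<close>, and those at \<open>y\<close> that have not been counted at \<open>x\<close> or \<open>A\<close>\<close>
    let ?E1 = "{x} \<times> (V - B `` {x})"
    let ?E2 = "((U - B\<inverse> `` {y}) - insert x A) \<times> {y}"
    have c1: "card ?E1 = m - card (B `` {x})"
      using sub finB by (simp add: card_cartesian_product card_Diff_subset card)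
    have "card ?E2 = card ((U - B\<inverse> `` {y}) - insert x A)" by (simp add: card_cartesian_product)
    also have "\<dots> \<ge> card (U - B\<inverse> `` {y}) - card (insert x A)"
      using A by (intro diff_card_le_card_Diff) auto
    also have "card (U - B\<inverse> `` {y}) = m - card (B\<inverse> `` {y})"
      using sub finB by (simp add: card_Diff_subset card)
    also have "card (insert x A) = b + 1" using xy A cA by simp
    finally have c2: "card ?E2 \<ge> m - card (B\<inverse> `` {y}) - (b + 1)" .
    have fE: "finite ?EA" "finite ?E1" "finite ?E2" using fin A by auto
    have "card (?EA \<union> ?E1 \<union> ?E2) = card ?EA + card ?E1 + card ?E2"
      using fE xy by (subst card_Un_disjoint; (subst card_Un_disjoint)?) auto
    moreover have "?EA \<union> ?E1 \<union> ?E2 \<subseteq> U \<times> V - B" using A xy by auto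
    then have "card (?EA \<union> ?E1 \<union> ?E2) \<le> card (U \<times> V - B)" by (rule card_mono[OF finE])
    moreover have "card (B `` {x}) + card (B\<inverse> `` {y}) \<le> m" using ore xy nB by auto
    ultimately have "b * (m - b) + (m - b - 1) \<le> card (U \<times> V - B)"
      using c1 c2 EA cA mb by simp
    moreover have "b * (m - b - 1) \<le> b * (m - b)" by (intro mult_le_mono) auto
    moreover have "(b + 1) * (m - b - 1) = b * (m - b - 1) + (m - b - 1)" by simp
    ultimately show False using few by linarith
  qed
  have "B `` A \<subseteq> B `` {u}"
  proof
    fix w assume "w \<in> B `` A"
    then obtain t where t: "t \<in> A" "(t, w) \<in> B" by blast
    have w: "w \<in> V" using t B by auto
    have "insert t (U - A) \<subseteq> B\<inverse> `` {w}" using full w t by auto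
    then have "card (insert t (U - A)) \<le> card (B\<inverse> `` {w})" by (rule card_mono[OF finB(2)])
    moreover have "card (insert t (U - A)) = m - b + 1"
      using t(1) A fin cA card by (simp add: card_Diff_subset)
    ultimately show "w \<in> B `` {u}"
      using ore[OF uv(1) w] uv(4) mb by (cases "(u, w) \<in> B") auto
  qed
  then show ?thesis using A(1) cA sub(1)[of u] uv(4) by blast
qed

text \<open>
  Let \<open>uv\<close> be a non-adjacent pair of largest degree sum, and \<open>t\<close> the degree of \<open>u\<close>.  At least \<open>t\<close>
  vertices are not adjacent to \<open>v\<close>, and by the choice of the pair each of them has degree at most
  \<open>t\<close>.  So there are at least \<open>t (m - t)\<close> non-edges, and the bound on their number leaves only the
  smallest possible degree \<open>b\<close> for \<open>u\<close> or for \<open>v\<close>.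
\<close>

lemma sparse_block_if_ore_maximal:
  fixes B :: "('a \<times> 'b) set"
  assumes fin: "finite U" "finite V" and card: "card U = m" "card V = m" and B: "B \<subset> U \<times> V"
    and ore: "\<And>u v. u \<in> U \<Longrightarrow> v \<in> V \<Longrightarrow> (u, v) \<notin> B \<Longrightarrow> card (B `` {u}) + card (B\<inverse> `` {v}) \<le> m"
    and few: "card (U \<times> V - B) < (b + 1) * (m - b - 1)"
    and deg: "\<And>u. u \<in> U \<Longrightarrow> b \<le> card (B `` {u})" "\<And>v. v \<in> V \<Longrightarrow> b \<le> card (B\<inverse> `` {v})"
  shows "(\<exists>T\<subseteq>U. \<exists>N\<subseteq>V. card T = b \<and> card N = b \<and> B `` T \<subseteq> N) \<or>
         (\<exists>T\<subseteq>V. \<exists>N\<subseteq>U. card T = b \<and> card N = b \<and> B\<inverse> `` T \<subseteq> N)"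
proof -
  define g where "g = (\<lambda>(u, v). card (B `` {u}) + card (B\<inverse> `` {v}))"
  have E: "finite (U \<times> V - B)" "U \<times> V - B \<noteq> {}" using fin B by auto
  then have "Max (g ` (U \<times> V - B)) \<in> g ` (U \<times> V - B)" by (intro Max_in) auto
  then obtain u v where uv: "u \<in> U" "v \<in> V" "(u, v) \<notin> B" and "g (u, v) = Max (g ` (U \<times> V - B))"
    by auto
  then have gmax: "g e \<le> g (u, v)" if "e \<in> U \<times> V - B" for e
    using E that by simp
  define t where "t = card (B `` {u})"
  define s where "s = card (B\<inverse> `` {v})"
  have ts: "t + s \<le> m" "b \<le> t" "b \<le> s" using ore[OF uv] deg uv by (auto simp: t_def s_def)
  have maxU: "card (B `` {u'}) \<le> t" if "u' \<in> U" "(u', v) \<notin> B" for u'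
    using gmax[of "(u', v)"] that uv by (simp add: g_def t_def)
  have maxV: "card (B\<inverse> `` {v'}) \<le> s" if "v' \<in> V" "(u, v') \<notin> B" for v'
    using gmax[of "(u, v')"] that uv by (simp add: g_def s_def)
  have finB: "finite (B `` {x})" "finite (B\<inverse> `` {y})" for x y
    using B fin by (auto intro: finite_subset[of _ V] finite_subset[of _ U])
  have sub: "B `` {x} \<subseteq> V" "B\<inverse> `` {y} \<subseteq> U" for x y using B by auto
  let ?A = "U - B\<inverse> `` {v}"
  let ?EA = "SIGMA x:?A. V - B `` {x}"
  have "t * (m - t) \<le> card ?A * (m - t)"
    using sub finB ts by (intro mult_right_mono) (auto simp: card_Diff_subset card s_def)
  also have "\<dots> = (\<Sum>x\<in>?A. m - t)" by simp
  also have "\<dots> \<le> (\<Sum>x\<in>?A. card (V - B `` {x}))"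
    using sub finB maxU by (intro sum_mono) (auto simp: card_Diff_subset card intro!: diff_le_mono2)
  also have "\<dots> = card ?EA" using fin by (subst card_SigmaI) auto
  also have "\<dots> \<le> card (U \<times> V - B)" by (rule card_mono[OF E(1)]) auto
  finally have le: "t * (m - t) \<le> card (U \<times> V - B)" .
  have "t = b \<or> s = b"
  proof (rule ccontr)
    assume "\<not> ?thesis"
    then have gt: "t \<ge> b + 1" "m - t \<ge> b + 1" using ts by auto
    obtain x y where x: "t = b + 1 + x" and y: "m - t = b + 1 + y"
      using gt le_Suc_ex by metis
    have "m - b - 1 = b + 1 + x + y" using x y by simp
    moreover have "t * (m - t) = (b + 1 + x) * (b + 1 + y)" by (simp only: y) (simp only: x)
    ultimately have "(b + 1) * (m - b - 1) \<le> t * (m - t)" by (simp add: algebra_simps)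
    with le few show False by simp
  qed
  then show ?thesis
  proof
    assume "t = b"
    then have "\<exists>T\<subseteq>U. \<exists>N\<subseteq>V. card T = b \<and> card N = b \<and> B `` T \<subseteq> N"
      using sparse_block_if_degree_eq[OF fin card _ ore few deg(1) uv] maxU B by (auto simp: t_def)
    then show ?thesis ..
  next
    assume sb: "s = b"
    have "U \<times> V - B = (V \<times> U - B\<inverse>)\<inverse>" by auto
    then have few': "card (V \<times> U - B\<inverse>) < (b + 1) * (m - b - 1)"
      using few by (metis card_inverse)
    have "\<exists>T\<subseteq>V. \<exists>N\<subseteq>U. card T = b \<and> card N = b \<and> B\<inverse> `` T \<subseteq> N"
    proof (rule sparse_block_if_degree_eq[OF fin(2,1) card(2,1) _ _ few' deg(2) uv(2,1)])
      show "B\<inverse> \<subseteq> V \<times> U" using B by auto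
      show "(v, u) \<notin> B\<inverse>" using uv by simp
      show "card (B\<inverse> `` {v}) = b" using sb by (simp add: s_def)
      show "card (B\<inverse> `` {v'}) \<le> b" if "v' \<in> V" "(v', u) \<notin> B\<inverse>" for v'
        using maxV that sb by simp
      show "card (B\<inverse> `` {v'}) + card ((B\<inverse>)\<inverse> `` {u'}) \<le> m" if "v' \<in> V" "u' \<in> U" "(v', u') \<notin> B\<inverse>" for v' u'
        using ore[of u' v'] that by simp
    qed
    then show ?thesis ..
  qed
qed

text \<open>
  With \<open>b = k - q\<close> and \<open>m = n - q\<close>: there are fewer than \<open>t (m - t)\<close> non-edges for \<open>t = b + 1\<close>.
\<close>

lemma nonedge_bound_arith:
  fixes n k q :: nat
  assumes "4 * k * (k + 1) \<le> n" "q < k"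
  shows "n * (k - q) + 1 < (k - q + 1) * (n - q - (k - q) - 1)"
proof -
  have 1: "n - q - (k - q) - 1 = n - k - 1" using assms by simp
  have "k * k + 2 * k + 2 < n"
  proof -
    have "4 * k * (k + 1) = k * k + 2 * k + (3 * (k * k) + 2 * k)" by (simp add: algebra_simps)
    moreover have "k * k \<ge> 1" using assms(2) by (cases k) auto
    ultimately show ?thesis using assms by linarith
  qed
  moreover have "(k - q + 1) * (k + 1) \<le> (k + 1) * (k + 1)" by (intro mult_right_mono) auto
  ultimately have 2: "(k - q + 1) * (k + 1) + 1 < n" by (simp add: algebra_simps)
  have "(k - q + 1) * (n - k - 1) = (k - q + 1) * n - (k - q + 1) * (k + 1)"
    by (simp add: diff_mult_distrib2)
  moreover have "(k - q + 1) * n = n * (k - q) + n" by simp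
  ultimately show ?thesis unfolding 1 using 2 by linarith
qed

text \<open>
  Deleting \<open>S1\<close> and \<open>S2\<close> lowers degrees by at most \<open>q\<close> and creates no non-edges, so
  \<open>sparse_block_if_ore_maximal\<close> applies to an edge-maximal non-Hamiltonian supergraph of what is left.  The \<open>k - q\<close>
  vertices found there and the \<open>q\<close> deleted vertices on the same side make up \<open>N\<close>.
\<close>

lemma extremal_block_if_nonhamiltonian:
  fixes B :: "('a \<times> 'b) set"
  assumes fin: "finite U" "finite V" and card: "card U = n" "card V = n" and B: "B \<subseteq> U \<times> V"
    and deg: "\<And>u. u \<in> U \<Longrightarrow> k \<le> card (B `` {u})" "\<And>v. v \<in> V \<Longrightarrow> k \<le> card (B\<inverse> `` {v})"
    and q: "q < k" and n: "4 * k * (k + 1) \<le> n"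
    and few: "card (U \<times> V - B) \<le> n * (k - q) + 1"
    and S: "S1 \<subseteq> U" "S2 \<subseteq> V" "card S1 = q" "card S2 = q"
    and nham: "\<not> ham_bip (U - S1) (V - S2) (B \<inter> (U - S1) \<times> (V - S2))"
  shows "(\<exists>T\<subseteq>U. \<exists>N\<subseteq>V. card T = k - q \<and> card N = k \<and> B `` T \<subseteq> N) \<or>
         (\<exists>T\<subseteq>V. \<exists>N\<subseteq>U. card T = k - q \<and> card N = k \<and> B\<inverse> `` T \<subseteq> N)"
proof -
  let ?U = "U - S1" and ?V = "V - S2" and ?B = "B \<inter> (U - S1) \<times> (V - S2)"
  define b m where "b = k - q" and "m = n - q"
  have finS: "finite S1" "finite S2" using S fin finite_subset by auto
  have fin': "finite ?U" "finite ?V" using fin by auto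
  have card': "card ?U = m" "card ?V = m"
    using S finS by (simp_all add: card_Diff_subset card m_def)
  obtain C where C: "?B \<subseteq> C" "C \<subset> ?U \<times> ?V"
    and ore: "\<And>u v. u \<in> ?U \<Longrightarrow> v \<in> ?V \<Longrightarrow> (u, v) \<notin> C \<Longrightarrow>
       card (C `` {u}) + card (C\<inverse> `` {v}) \<le> card ?U"
    using maximal_nonhamiltonian_supergraph[OF fin' _ _ nham] card' by auto
  have finC: "finite (C `` {x})" "finite (C\<inverse> `` {y})" for x y
    using C fin' by (auto intro: finite_subset[of _ ?V] finite_subset[of _ ?U])
  have few': "card (?U \<times> ?V - C) < (b + 1) * (m - b - 1)"
  proof -
    have "card (?U \<times> ?V - C) \<le> card (U \<times> V - B)"
      by (rule card_mono) (use fin C in auto)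
    also have "\<dots> \<le> n * (k - q) + 1" by (rule few)
    also have "\<dots> < (b + 1) * (m - b - 1)"
      unfolding b_def m_def by (rule nonedge_bound_arith[OF n q])
    finally show ?thesis .
  qed
  have deg1: "b \<le> card (C `` {u})" if "u \<in> ?U" for u
  proof -
    have "B `` {u} - S2 \<subseteq> C `` {u}" using C(1) B that by auto
    then have "card (B `` {u} - S2) \<le> card (C `` {u})" by (rule card_mono[OF finC(1)])
    moreover have "card (B `` {u}) - card S2 \<le> card (B `` {u} - S2)"
      by (rule diff_card_le_card_Diff[OF finS(2)])
    ultimately show ?thesis using deg(1)[of u] that S by (simp add: b_def)
  qed
  have deg2: "b \<le> card (C\<inverse> `` {v})" if "v \<in> ?V" for v
  proof -
    have "B\<inverse> `` {v} - S1 \<subseteq> C\<inverse> `` {v}" using C(1) B that by auto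
    then have "card (B\<inverse> `` {v} - S1) \<le> card (C\<inverse> `` {v})" by (rule card_mono[OF finC(2)])
    moreover have "card (B\<inverse> `` {v}) - card S1 \<le> card (B\<inverse> `` {v} - S1)"
      by (rule diff_card_le_card_Diff[OF finS(1)])
    ultimately show ?thesis using deg(2)[of v] that S by (simp add: b_def)
  qed
  have bq: "b + q = k" using q by (simp add: b_def)
  have "(\<exists>T\<subseteq>?U. \<exists>N\<subseteq>?V. card T = b \<and> card N = b \<and> C `` T \<subseteq> N) \<or>
        (\<exists>T\<subseteq>?V. \<exists>N\<subseteq>?U. card T = b \<and> card N = b \<and> C\<inverse> `` T \<subseteq> N)"
    by (rule sparse_block_if_ore_maximal[OF fin' card' C(2) _ few'])
      (use ore deg1 deg2 card' in auto)
  then show ?thesis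
  proof (elim disjE exE conjE)
    fix T N assume TN: "T \<subseteq> ?U" "N \<subseteq> ?V" "card T = b" "card N = b" "C `` T \<subseteq> N"
    have "finite N" using TN fin' finite_subset by auto
    then have "card (N \<union> S2) = k" using TN S finS bq by (subst card_Un_disjoint) auto
    moreover have "B `` T \<subseteq> N \<union> S2" using TN C(1) B by blast
    ultimately show ?thesis using TN S b_def by (intro disjI1 exI[of _ T] conjI exI[of _ "N \<union> S2"]) auto
  next
    fix T N assume TN: "T \<subseteq> ?V" "N \<subseteq> ?U" "card T = b" "card N = b" "C\<inverse> `` T \<subseteq> N"
    have "finite N" using TN fin' finite_subset by auto
    then have "card (N \<union> S1) = k" using TN S finS bq by (subst card_Un_disjoint) auto
    moreover have "B\<inverse> `` T \<subseteq> N \<union> S1" using TN C(1) B by blast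
    ultimately show ?thesis using TN S b_def by (intro disjI2 exI[of _ T] conjI exI[of _ "N \<union> S1"]) auto
  qed
qed

section \<open>The extremal graphs\<close>

text \<open>
  The edges of \<open>F\<close>: the side \<open>U\<close> plays the role of \<open>Y\<close>, \<open>T\<close> that of \<open>Y\<^sub>1\<close>, and \<open>N\<close> that of the
  complement of \<open>X\<^sub>1\<close> in \<open>X\<close>.
\<close>

definition block_edges :: "'a set \<Rightarrow> 'a set \<Rightarrow> 'a set \<Rightarrow> 'a set \<Rightarrow> ('a \<times> 'a) set" where
  "block_edges U V T N = U \<times> V - T \<times> (V - N)"

locale block =
  fixes U V T N :: "'a set" and n b k :: nat
  assumes fin: "finite U" "finite V" and disj: "U \<inter> V = {}"
    and card: "card U = n" "card V = n" "card T = b" "card N = k"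
    and sub: "T \<subseteq> U" "N \<subseteq> V"
    and bk: "0 < b" "b \<le> k" and n: "4 * k * (k + 1) \<le> n"
begin

lemma n_large: "8 \<le> n" "k + 7 \<le> n"
proof -
  have "k * k \<ge> k" using bk by (cases k) auto
  moreover have "4 * k * (k + 1) = 4 * (k * k) + 4 * k" by simp
  ultimately show "8 \<le> n" "k + 7 \<le> n" using n bk by linarith+
qed

lemma finTN: "finite T" "finite N" using fin sub finite_subset by auto

lemma card_compl: "card (U - T) = n - b" "card (V - N) = n - k"
  using finTN sub card by (simp_all add: card_Diff_subset)

lemma compl_nonempty: "U - T \<noteq> {}" "V - N \<noteq> {}"
proof -
  have "card (U - T) > 0" "card (V - N) > 0" unfolding card_compl using n_large bk by linarith+
  then show "U - T \<noteq> {}" "V - N \<noteq> {}" by fastforce+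
qed

lemma ex_other: assumes "y \<in> U - T" shows "\<exists>y'\<in>U - T. y' \<noteq> y"
proof (rule ccontr)
  assume "\<not> ?thesis"
  then have "U - T \<subseteq> {y}" by blast
  then have "card (U - T) \<le> 1" using card_mono[of "{y}" "U - T"] by simp
  then show False using card_compl n_large bk by simp
qed

text \<open>
  The Rayleigh quotient of \<open>F\<^sup>0\<close> at a function that takes the value \<open>s\<close> on \<open>V\<close>, \<open>\<alpha>\<close> on \<open>T\<close>, \<open>\<gamma>\<close> at \<open>y\<close> and
  \<open>\<beta>\<close> on the rest of \<open>U\<close>.
\<close>

lemma block_rayleigh:
  fixes c s \<alpha> \<beta> \<gamma> :: real
  assumes y: "y \<in> U - T" and x0: "x0 \<in> V - N"
  defines "R \<equiv> graph_radius c (U \<union> V) (both_arcs (block_edges U V T N - {(y, x0)}))"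
  defines "g \<equiv> \<lambda>x. 2 * x * s + c * (x^2 + s^2)"
  shows "real k * real b * g \<alpha> + real n * (real n - real b - 1) * g \<beta> + (real n - 1) * g \<gamma>
    \<le> R * (real n * s^2 + real b * \<alpha>^2 + (real n - real b - 1) * \<beta>^2 + \<gamma>^2)"
proof -
  let ?B = "block_edges U V T N - {(y, x0)}"
  define f where "f w = (if w \<in> V then s else if w \<in> T then \<alpha> else if w = y then \<gamma> else \<beta>)" for w
  let ?R = "U - T - {y}"
  have fT: "f w = \<alpha>" if "w \<in> T" for w using that sub disj by (auto simp: f_def)
  have fR: "f w = \<beta>" if "w \<in> ?R" for w using that sub disj by (auto simp: f_def)
  have fy: "f y = \<gamma>" using y disj by (auto simp: f_def)
  have fV: "f w = s" if "w \<in> V" for w using that by (auto simp: f_def)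
  have cR: "real (card ?R) = real n - real b - 1"
    using y card_compl(1) n_large bk fin by simp
  have split: "(\<Sum>u\<in>U. h u) = (\<Sum>u\<in>T. h u) + ((\<Sum>u\<in>?R. h u) + h y)" for h :: "'a \<Rightarrow> real"
  proof -
    have "(\<Sum>u\<in>U. h u) = (\<Sum>u\<in>U - T. h u) + (\<Sum>u\<in>T. h u)"
      by (rule sum.subset_diff[OF sub(1) fin(1)])
    also have "(\<Sum>u\<in>U - T. h u) = h y + (\<Sum>u\<in>?R. h u)"
      using y fin by (intro sum.remove) auto
    finally show ?thesis by simp
  qed
  have rows: "?B `` {u} = N" if "u \<in> T" for u
    using that sub y by (auto simp: block_edges_def)
  have rowsR: "?B `` {u} = V" if "u \<in> ?R" for u
    using that by (auto simp: block_edges_def)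
  have rowy: "?B `` {y} = V - {x0}"
    using y by (auto simp: block_edges_def)
  have cy: "real (card (V - {x0})) = real n - 1"
    using x0 card fin n_large by simp
  have "(\<Sum>e\<in>?B. edge_weight c f e) = (\<Sum>(u, v)\<in>(SIGMA u:U. ?B `` {u}). edge_weight c f (u, v))"
    by (rule sum.cong) (auto simp: block_edges_def)
  also have "\<dots> = (\<Sum>u\<in>U. \<Sum>v\<in>?B `` {u}. edge_weight c f (u, v))"
    using fin by (intro sum.Sigma[symmetric]) (auto simp: block_edges_def intro: finite_subset[of _ V])
  also have "\<dots> = (\<Sum>u\<in>U. real (card (?B `` {u})) * g (f u))"
  proof (rule sum.cong[OF refl])
    fix u assume "u \<in> U"
    have "(\<Sum>v\<in>?B `` {u}. edge_weight c f (u, v)) = (\<Sum>v\<in>?B `` {u}. g (f u))"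
      by (rule sum.cong) (auto simp: edge_weight_def g_def fV block_edges_def)
    then show "(\<Sum>v\<in>?B `` {u}. edge_weight c f (u, v)) = real (card (?B `` {u})) * g (f u)" by simp
  qed
  also have "\<dots> = (\<Sum>u\<in>T. real k * g \<alpha>) + ((\<Sum>u\<in>?R. real n * g \<beta>) + (real n - 1) * g \<gamma>)"
    unfolding split by (intro arg_cong2[of _ _ _ _ "(+)"] sum.cong refl)
      (simp_all only: rows rowsR rowy card cy fT fR fy)
  also have "\<dots> = real k * real b * g \<alpha> + real n * (real n - real b - 1) * g \<beta> + (real n - 1) * g \<gamma>"
    by (simp only: sum_constant cR card) simp
  finally have lhs: "(\<Sum>e\<in>?B. edge_weight c f e) = \<dots>" .
  have "(\<Sum>u\<in>U \<union> V. (f u)^2) = (\<Sum>u\<in>U. (f u)^2) + (\<Sum>u\<in>V. (f u)^2)"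
    using fin disj by (intro sum.union_disjoint) auto
  also have "(\<Sum>u\<in>V. (f u)^2) = (\<Sum>u\<in>V. s^2)" using fV by simp
  also have "(\<Sum>u\<in>U. (f u)^2) = (\<Sum>u\<in>T. \<alpha>^2) + ((\<Sum>u\<in>?R. \<beta>^2) + \<gamma>^2)"
    unfolding split by (intro arg_cong2[of _ _ _ _ "(+)"] sum.cong refl) (simp_all only: fT fR fy)
  finally have rhs: "(\<Sum>u\<in>U \<union> V. (f u)^2) =
      real n * s^2 + real b * \<alpha>^2 + (real n - real b - 1) * \<beta>^2 + \<gamma>^2"
    by (simp only: sum_constant cR card)
  have "(\<Sum>e\<in>?B. edge_weight c f e) \<le> R * (\<Sum>u\<in>U \<union> V. (f u)^2)"
    unfolding R_def using fin y disj by (intro bipartite_rayleigh) (auto simp: block_edges_def)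
  then show ?thesis unfolding lhs rhs .
qed

text \<open>
  The test function is the constant \<open>s\<close> on \<open>V\<close> and the degree on \<open>U\<close>; the sum \<open>W\<close> of the squared degrees
  is slightly larger than \<open>n (n (n - b) - 2)\<close>.
\<close>

lemma adjacency_radius_block_gt:
  assumes y: "y \<in> U - T" and x0: "x0 \<in> V - N"
  defines "R \<equiv> graph_radius 0 (U \<union> V) (both_arcs (block_edges U V T N - {(y, x0)}))"
  shows "0 < R" "real n * (real n - real b) - 2 < R^2"
proof -
  define W where "W = real b * real k^2 + (real n - real b - 1) * real n^2 + (real n - 1)^2"
  have nb: "real n - real b - 1 \<ge> 0" "real n - 1 > 0" using n_large bk by auto
  have W: "W > 0" unfolding W_def using nb by (intro add_nonneg_pos add_nonneg_nonneg) auto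
  have key: "2 * s * W \<le> R * (real n * s^2 + W)" for s
    using block_rayleigh[OF y x0, where s = s and c = 0 and \<alpha> = k and \<beta> = n and \<gamma> = "real n - 1"]
    by (simp add: R_def W_def power2_eq_square algebra_simps)
  have "R * (real n + W) > 0" using key[of 1] W by simp
  then show R: "0 < R" using W by (simp add: zero_less_mult_iff)
  \<comment> \<open>as for an eigenfunction, the values at the neighbours of \<open>u\<close> in \<open>U\<close> add up to \<open>R\<close> times that at \<open>u\<close>\<close>
  have "R * (2 * W) \<le> R * (real n * R^2 + W)" using key[of R] by (simp add: mult_ac)
  then have "W \<le> real n * R^2" using R by simp
  moreover have "W = real n * (real n * (real n - real b) - 2) + (real b * real k^2 + 1)"
    by (simp add: W_def power2_eq_square algebra_simps)
  moreover have "real b * real k^2 \<ge> 0" by simp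
  ultimately have "real n * (real n * (real n - real b) - 2) < real n * R^2" by linarith
  then show "real n * (real n - real b) - 2 < R^2"
    using n_large by (simp add: mult_less_cancel_left)
qed

text \<open>
  The test function is the top eigenvector of the signless Laplacian of the complete bipartite graph
  between \<open>U - T\<close> and \<open>V\<close>, extended by 0 on \<open>T\<close>.  The deleted edge costs slightly more than
  \<open>2 / n\<close>; the \<open>b k\<close> edges at \<open>T\<close> make up for the difference because \<open>n\<close> is large compared with \<open>k\<close>.
\<close>

lemma signless_radius_block_gt:
  assumes y: "y \<in> U - T" and x0: "x0 \<in> V - N"
  defines "R \<equiv> graph_radius 1 (U \<union> V) (both_arcs (block_edges U V T N - {(y, x0)}))"
  shows "(real n * (real n - real b) - 2) / n + n < R"
proof (rule ccontr)
  define a where "a = real n - real b"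
  have a: "a > 0" "real n \<le> a + k" "real b = n - a" "a \<ge> 3" using n_large bk by (auto simp: a_def)
  assume "\<not> ?thesis"
  then have "R \<le> (real n * a - 2) / n + n" by (simp add: a_def)
  then have Rn: "R * n \<le> real n * a - 2 + real n * n" using n_large by (simp add: field_simps)
  have "real k * (real n - a) * a^2 + (real n * a - 1) * (real n + a)^2 \<le> R * n * (a * (real n + a))"
    using block_rayleigh[OF y x0, where s = a and c = 1 and \<alpha> = 0 and \<beta> = n and \<gamma> = n]
    unfolding R_def[symmetric] a(3)
    by (simp add: power2_eq_square algebra_simps)
  also have "\<dots> \<le> (real n * a - 2 + real n * n) * (a * (real n + a))"
    using Rn a by (intro mult_right_mono) auto
  finally have "real k * (real n - a) * a^2 \<le> (real n - a) * (real n + a)"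
    by (simp add: power2_eq_square algebra_simps)
  moreover have "real n - a > 0" using a(3) bk by simp
  ultimately have "real k * a^2 \<le> real n + a"
    by (simp add: mult.commute mult.left_commute)
  moreover have "real k * a^2 \<ge> real k * (3 * a)"
    using a by (intro mult_left_mono) (auto simp: power2_eq_square)
  moreover have "real k * a \<ge> a" "real k * a \<ge> real k * 3" using a bk by auto
  ultimately show False using a bk by simp
qed

text \<open>
  A graph with at most \<open>n (n - b) - 2\<close> edges has an upper bound for its radius that is below the lower
  bound for that of \<open>F\<^sup>0\<close>.
\<close>

lemma nonedges_le:
  assumes B: "B \<subseteq> U \<times> V" and deg: "\<And>w. w \<in> U \<union> V \<Longrightarrow> both_arcs B `` {w} \<noteq> {}"
    and y: "y \<in> U - T" and x0: "x0 \<in> V - N" and "c = 0 \<or> c = 1"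
    and le: "graph_radius c (U \<union> V) (both_arcs (block_edges U V T N - {(y, x0)})) \<le> graph_radius c (U \<union> V) (both_arcs B)"
  shows "card (U \<times> V - B) \<le> n * b + 1"
proof -
  have n0: "n > 0" "U \<noteq> {}" using n_large card by auto
  have e: "real n * (real n - real b) - 2 < card B"
    using \<open>c = 0 \<or> c = 1\<close>
  proof
    assume c: "c = 0"
    show ?thesis
      using adjacency_radius_block_gt[OF y x0] le[unfolded c]
        adjacency_radius_square_le_edges[OF fin n0(2) disj B]
      by (smt (verit) power_mono)
  next
    assume c: "c = 1"
    have "(real n * (real n - real b) - 2) / n + n < card B / n + n"
      using signless_radius_block_gt[OF y x0] le[unfolded c]
        signless_radius_le_edges[OF fin card(1,2) n0(1) disj B deg] by linarith
    then show ?thesis using n0 by (simp add: divide_less_cancel)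
  qed
  have "finite B" using B fin finite_subset by blast
  then have "card (U \<times> V - B) = n * n - card B"
    using B card by (simp add: card_Diff_subset card_cartesian_product)
  moreover have "real (n * n) < real (card B + n * b + 2)"
    using e by (simp add: algebra_simps)
  then have "n * n < card B + n * b + 2" by (simp only: of_nat_less_iff)
  ultimately show ?thesis by simp
qed

text \<open>
  Some vertex of \<open>U - T\<close> is still adjacent to all of \<open>V\<close>, and every vertex of \<open>N\<close> to all of \<open>U\<close>.
\<close>

lemma block_connected:
  assumes y: "y \<in> U - T" and x0: "x0 \<in> V - N"
    and Z: "Z \<subseteq> U \<union> V" "Z \<noteq> {}" "both_arcs (block_edges U V T N - {(y, x0)}) `` Z \<subseteq> Z"
  shows "Z = U \<union> V"
proof -
  obtain y' where y': "y' \<in> U - T" "y' \<noteq> y" using ex_other[OF y] by blast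
  have "N \<noteq> {}" using card bk by auto
  then obtain x where x: "x \<in> N" by blast
  let ?E = "both_arcs (block_edges U V T N - {(y, x0)})"
  have step: "w \<in> Z" if "(z, w) \<in> ?E" "z \<in> Z" for z w using Z(3) that by blast
  have Ux: "(u, x) \<in> ?E" "(x, u) \<in> ?E" if "u \<in> U" for u
    using that x x0 sub by (auto simp: both_arcs_def block_edges_def)
  have Vy: "(y', v) \<in> ?E" "(v, y') \<in> ?E" if "v \<in> V" for v
    using that y' by (auto simp: both_arcs_def block_edges_def)
  obtain z where z: "z \<in> Z" using Z by blast
  have xV: "x \<in> V" using x sub by auto
  have "y' \<in> Z"
  proof (cases "z \<in> V")
    case True
    then show ?thesis using step[OF Vy(2)] z by blast
  next
    case False
    then have "x \<in> Z" using step[OF Ux(1)] z Z(1) by blast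
    then show ?thesis using step[OF Vy(2)] xV by blast
  qed
  then have "V \<subseteq> Z" using step[OF Vy(1)] by blast
  moreover from this have "U \<subseteq> Z" using step[OF Ux(2)] xV by blast
  ultimately show ?thesis using Z by blast
qed

text \<open>
  The edges \<open>X\<close> of \<open>B\<close> are exchanged for the edges \<open>X'\<close> of a copy of \<open>F\<^sup>0\<close> without decreasing the
  quadratic form at the top eigenfunction of \<open>B\<close>.
\<close>

lemma radius_less_block_if_exchange:
  assumes B: "B \<subseteq> U \<times> V" and "c \<ge> 0" and y: "y \<in> U - T" and x0: "x0 \<in> V - N"
    and f: "\<And>u. f u \<ge> 0"
      "eigenfunction (U \<union> V) (graph_kernel c (both_arcs B)) (graph_radius c (U \<union> V) (both_arcs B)) f"
    and X: "X \<subseteq> B" "X' \<subseteq> block_edges U V T N - {(y, x0)}"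
      "B - X \<subseteq> block_edges U V T N - {(y, x0)} - X'"
      "(\<Sum>e\<in>X. edge_weight c f e) \<le> (\<Sum>e\<in>X'. edge_weight c f e)"
    and z: "z \<in> U \<union> V" "both_arcs B `` {z} \<subset> both_arcs (block_edges U V T N - {(y, x0)}) `` {z}"
  shows "graph_radius c (U \<union> V) (both_arcs B) <
    graph_radius c (U \<union> V) (both_arcs (block_edges U V T N - {(y, x0)}))"
proof -
  let ?B0 = "block_edges U V T N - {(y, x0)}"
  have B0: "?B0 \<subseteq> U \<times> V" by (auto simp: block_edges_def)
  have finB: "finite B" "finite ?B0" using B B0 fin finite_subset by blast+
  have "(\<Sum>e\<in>B. edge_weight c f e) = (\<Sum>e\<in>B - X. edge_weight c f e) + (\<Sum>e\<in>X. edge_weight c f e)"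
    using X(1) finB by (intro sum.subset_diff)
  also have "\<dots> \<le> (\<Sum>e\<in>?B0 - X'. edge_weight c f e) + (\<Sum>e\<in>X'. edge_weight c f e)"
    using X(3) finB f(1) \<open>c \<ge> 0\<close>
    by (intro add_mono[OF _ X(4)] sum_mono2) (auto intro: edge_weight_nonneg)
  also have "\<dots> = (\<Sum>e\<in>?B0. edge_weight c f e)"
    using X(2) finB by (intro sum.subset_diff[symmetric])
  finally have le: "quad_form (U \<union> V) (graph_kernel c (both_arcs B)) f
      \<le> quad_form (U \<union> V) (graph_kernel c (both_arcs ?B0)) f"
    unfolding bipartite_quad_form[OF fin disj B] bipartite_quad_form[OF fin disj B0] .
  show ?thesis
  proof (rule graph_radius_less[OF _ _ both_arcs_subset[OF B] both_arcs_subset[OF B0] sym_both_arcs \<open>c \<ge> 0\<close> f le z])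
    show "finite (U \<union> V)" using fin by simp
    show "U \<union> V \<noteq> {}" using y by auto
    show "Z = U \<union> V" if "Z \<subseteq> U \<union> V" "Z \<noteq> {}" "both_arcs ?B0 `` Z \<subseteq> Z" for Z
      using block_connected[OF y x0 that] .
  qed
qed

text \<open>
  Which copy of \<open>F\<^sup>0\<close> wins depends on the top eigenfunction \<open>f\<close>: after the exchange of the edges at
  \<open>T\<close>, the vertex \<open>x0\<close> takes the place of \<open>x\<close> in \<open>N\<close>, and the edge \<open>yx\<close>, missing from the outset, is the
  one that \<open>F\<^sup>0\<close> lacks.
\<close>

lemma radius_less_some_block:
  assumes B: "B \<subseteq> block_edges U V T N" "B \<noteq> block_edges U V T N" "T \<times> N \<subseteq> B" and "c \<ge> 0"
  shows "\<exists>N' y x0. block U V T N' n b k \<and> y \<in> U - T \<and> x0 \<in> V - N' \<and>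
    (B = block_edges U V T N' - {(y, x0)} \<or>
     graph_radius c (U \<union> V) (both_arcs B) <
       graph_radius c (U \<union> V) (both_arcs (block_edges U V T N' - {(y, x0)})))"
proof -
  have BUV: "B \<subseteq> U \<times> V" using B by (auto simp: block_edges_def)
  have blk: "block U V T N n b k" by unfold_locales
  have imU: "both_arcs C `` {u} = C `` {u}" if "C \<subseteq> U \<times> V" "u \<in> U" for u C
    using that disj by (auto simp: both_arcs_def)
  have imV: "both_arcs C `` {v} = C\<inverse> `` {v}" if "C \<subseteq> U \<times> V" "v \<in> V" for v C
    using that disj by (auto simp: both_arcs_def)
  have blkUV: "block_edges U V T N' - {e} \<subseteq> U \<times> V" for N' e by (auto simp: block_edges_def)
  obtain f where f: "\<And>u. f u \<ge> 0"
      "eigenfunction (U \<union> V) (graph_kernel c (both_arcs B)) (graph_radius c (U \<union> V) (both_arcs B)) f"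
  proof (rule nonneg_top_eigenfunction[of "U \<union> V" "graph_kernel c (both_arcs B)"])
    show "finite (U \<union> V)" using fin by simp
    show "U \<union> V \<noteq> {}" using card n_large by auto
    show "graph_kernel c (both_arcs B) u v = graph_kernel c (both_arcs B) v u" for u v
      by (rule graph_kernel_commute[OF sym_both_arcs])
    show "graph_kernel c (both_arcs B) u v \<ge> 0" for u v
      using \<open>c \<ge> 0\<close> by (auto simp: graph_kernel_def)
  qed (use that in \<open>auto simp: graph_radius_def\<close>)
  show ?thesis
  proof (cases "\<exists>y x0. (y, x0) \<in> block_edges U V T N - B \<and> x0 \<notin> N")
    case True
    then obtain y x0 where yx: "(y, x0) \<in> block_edges U V T N - B" "x0 \<notin> N" by blast
    then have y: "y \<in> U - T" and x0: "x0 \<in> V - N" by (auto simp: block_edges_def)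
    let ?B0 = "block_edges U V T N - {(y, x0)}"
    have "B = ?B0 \<or> graph_radius c (U \<union> V) (both_arcs B) < graph_radius c (U \<union> V) (both_arcs ?B0)"
    proof (rule disj_commute[THEN iffD1, OF disjCI])
      assume ne: "B \<noteq> ?B0"
      have "B \<subseteq> ?B0" using B yx by auto
      with ne obtain u v where uv: "(u, v) \<in> ?B0 - B" by auto
      then have u: "u \<in> U" by (auto simp: block_edges_def)
      show "graph_radius c (U \<union> V) (both_arcs B) < graph_radius c (U \<union> V) (both_arcs ?B0)"
      proof (rule radius_less_block_if_exchange[OF BUV \<open>c \<ge> 0\<close> y x0 f, of "{}" "{}" u])
        show "both_arcs B `` {u} \<subset> both_arcs ?B0 `` {u}"
          unfolding imU[OF BUV u] imU[OF blkUV u] using \<open>B \<subseteq> ?B0\<close> uv by blast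
      qed (use \<open>B \<subseteq> ?B0\<close> u in auto)
    qed
    then show ?thesis using blk y x0 by blast
  next
    case False
    obtain y x where yx: "(y, x) \<in> block_edges U V T N - B" using B by auto
    then have x: "x \<in> N" using False by blast
    then have y: "y \<in> U - T" using yx B(3) by (auto simp: block_edges_def)
    have xV: "x \<in> V" using x sub by auto
    obtain x0 where x0: "x0 \<in> V - N" using compl_nonempty(2) by blast
    have col: "(u, x0) \<in> B" if "u \<in> U - T" for u
      using False that x0 by (auto simp: block_edges_def)
    have Tx0: "(t, x0) \<notin> B" if "t \<in> T" for t
      using that x0 B(1) by (auto simp: block_edges_def)
    obtain t where t: "t \<in> T" using card bk by fastforce
    show ?thesis
    proof (cases "f x0 \<le> f x")
      case True
      let ?B0 = "block_edges U V T N - {(y, x0)}"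
      have "graph_radius c (U \<union> V) (both_arcs B) < graph_radius c (U \<union> V) (both_arcs ?B0)"
      proof (rule radius_less_block_if_exchange[OF BUV \<open>c \<ge> 0\<close> y x0 f,
            of "{(y, x0)}" "{(y, x)}" x])
        have "f y * f x0 \<le> f y * f x" "c * (f x0)^2 \<le> c * (f x)^2"
          using True f(1) \<open>c \<ge> 0\<close> by (auto intro!: mult_left_mono power_mono)
        then show "(\<Sum>e\<in>{(y, x0)}. edge_weight c f e) \<le> (\<Sum>e\<in>{(y, x)}. edge_weight c f e)"
          by (simp add: edge_weight_def algebra_simps)
        have "both_arcs B `` {x} \<subset> U" unfolding imV[OF BUV xV] using BUV yx y by blast
        moreover have "both_arcs ?B0 `` {x} = U"
          unfolding imV[OF blkUV xV] using x xV x0 by (auto simp: block_edges_def)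
        ultimately show "both_arcs B `` {x} \<subset> both_arcs ?B0 `` {x}" by simp
      qed (use B x x0 xV y yx col in \<open>auto simp: block_edges_def\<close>)
      then show ?thesis using blk y x0 by blast
    next
      case False
      let ?N = "insert x0 (N - {x})"
      let ?B0 = "block_edges U V T ?N - {(y, x)}"
      have x': "x \<in> V - ?N" using xV x x0 by auto
      have x0V: "x0 \<in> V" using x0 by simp
      have "card ?N = k" using x x0 finTN card bk by (simp add: card_insert_if)
      then interpret N': block U V T ?N n b k
        using fin disj card sub bk n x0 by unfold_locales auto
      have "graph_radius c (U \<union> V) (both_arcs B) < graph_radius c (U \<union> V) (both_arcs ?B0)"
      proof (rule N'.radius_less_block_if_exchange[OF BUV \<open>c \<ge> 0\<close> y x' f,
            of "T \<times> {x}" "T \<times> {x0}" x0])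
        have "f t * f x \<le> f t * f x0" "c * (f x)^2 \<le> c * (f x0)^2" for t
          using False f(1) \<open>c \<ge> 0\<close> by (auto intro!: mult_left_mono power_mono)
        then have "(\<Sum>t\<in>T. edge_weight c f (t, x)) \<le> (\<Sum>t\<in>T. edge_weight c f (t, x0))"
          by (intro sum_mono) (simp add: edge_weight_def algebra_simps add_mono)
        moreover have "(\<Sum>e\<in>T \<times> {w}. edge_weight c f e) = (\<Sum>t\<in>T. edge_weight c f (t, w))" for w
          using sum.cartesian_product[of "\<lambda>t v. edge_weight c f (t, v)" "{w}" T] by simp
        ultimately show "(\<Sum>e\<in>T \<times> {x}. edge_weight c f e) \<le> (\<Sum>e\<in>T \<times> {x0}. edge_weight c f e)"
          by simp
        have "both_arcs B `` {x0} \<subset> U" unfolding imV[OF BUV x0V] using BUV Tx0 t sub by blast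
        moreover have "both_arcs ?B0 `` {x0} = U"
          unfolding imV[OF blkUV x0V] using x x0 by (auto simp: block_edges_def)
        ultimately show "both_arcs B `` {x0} \<subset> both_arcs ?B0 `` {x0}" by simp
        show "T \<times> {x} \<subseteq> B" using B(3) x by auto
        show "T \<times> {x0} \<subseteq> ?B0" using x0 x y sub by (auto simp: block_edges_def)
        show "B - T \<times> {x} \<subseteq> ?B0 - T \<times> {x0}"
          using B(1) yx Tx0 by (auto simp: block_edges_def)
        show "x0 \<in> U \<union> V" using x0V by simp
      qed
      then show ?thesis using N'.block_axioms y x' by blast
    qed
  qed
qed

end

section \<open>Isomorphic copies of the extremal graphs\<close>

text \<open>
  An enumeration of \<open>A\<close> that lists \<open>S\<close> first and has a prescribed value at one position: an enumeration
  of \<open>S\<close> is continued by one of its complement, and a transposition then moves \<open>a\<close> into place.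
\<close>

lemma bij_betw_marked:
  assumes A: "finite A" "card A = n" and S: "S \<subseteq> A" "card S = r" and a: "a \<in> A"
    and p: "p < n" "p < r \<longleftrightarrow> a \<in> S"
  obtains h where "bij_betw h {..<n} A" "\<And>i. i < n \<Longrightarrow> h i \<in> S \<longleftrightarrow> i < r" "h p = a"
proof -
  have finS: "finite S" using A S finite_subset by auto
  have "card (A - S) = n - r" using A S finS by (simp add: card_Diff_subset)
  then have "card (A - S) = card {r..<n}" by simp
  then obtain h2 where h2: "bij_betw h2 {r..<n} (A - S)"
    using finite_same_card_bij[of "{r..<n}" "A - S"] A by auto
  obtain h1 where h1: "bij_betw h1 {..<r} S"
    using finite_same_card_bij[of "{..<r}" S] finS S by auto
  define h0 where "h0 = (\<lambda>i. if i \<in> {..<r} then h1 i else h2 i)"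
  have rn: "r \<le> n" using card_mono[OF A(1) S(1)] A S by simp
  have "bij_betw h0 ({..<r} \<union> {r..<n}) (S \<union> (A - S))"
    unfolding h0_def using h1 h2 by (intro bij_betw_disjoint_Un) auto
  moreover have "{..<r} \<union> {r..<n} = {..<n}" "S \<union> (A - S) = A" using rn S by auto
  ultimately have h0: "bij_betw h0 {..<n} A" by simp
  have h0S: "h0 i \<in> S \<longleftrightarrow> i < r" if "i < n" for i
    using bij_betwE[OF h1] bij_betwE[OF h2] that by (cases "i < r") (auto simp: h0_def)
  \<comment> \<open>the transposition of \<open>a\<close> and \<open>h0 p\<close>\<close>
  define \<tau> where "\<tau> x = (if x = a then h0 p else if x = h0 p then a else x)" for x
  have "h0 p \<in> A" using h0 p(1) by (auto simp: bij_betw_def)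
  then have \<tau>: "bij_betw \<tau> A A" using a by (intro bij_betw_if_involution) (auto simp: \<tau>_def)
  have \<tau>S: "\<tau> x \<in> S \<longleftrightarrow> x \<in> S" for x using h0S[OF p(1)] p(2) by (auto simp: \<tau>_def)
  show ?thesis
  proof (rule that[of "\<tau> \<circ> h0"])
    show "bij_betw (\<tau> \<circ> h0) {..<n} A" using h0 \<tau> by (rule bij_betw_trans)
    show "(\<tau> \<circ> h0) i \<in> S \<longleftrightarrow> i < r" if "i < n" for i using that h0S \<tau>S by simp
    show "(\<tau> \<circ> h0) p = a" by (simp add: \<tau>_def)
  qed
qed

definition arc_iso :: "('a \<Rightarrow> 'b) \<Rightarrow> 'a set \<Rightarrow> 'a rel \<Rightarrow> 'b set \<Rightarrow> 'b rel \<Rightarrow> bool" where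
  "arc_iso h P E Q E' \<longleftrightarrow> bij_betw h P Q \<and> E \<subseteq> P \<times> P \<and> E' \<subseteq> Q \<times> Q \<and>
     (\<forall>u\<in>P. \<forall>v\<in>P. (u, v) \<in> E \<longleftrightarrow> (h u, h v) \<in> E')"

lemma arc_iso_image:
  assumes "arc_iso h P E Q E'"
  shows "map_prod h h ` E = E'"
proof
  show "map_prod h h ` E \<subseteq> E'" using assms by (auto simp: arc_iso_def)
  show "E' \<subseteq> map_prod h h ` E"
  proof
    fix e assume e: "e \<in> E'"
    then have "fst e \<in> h ` P" "snd e \<in> h ` P" using assms by (auto simp: arc_iso_def bij_betw_def)
    then obtain u v where uv: "u \<in> P" "v \<in> P" "e = (h u, h v)" by (metis imageE prod.collapse)
    then have "(u, v) \<in> E" using assms e by (auto simp: arc_iso_def)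
    then show "e \<in> map_prod h h ` E" using uv by (auto intro: image_eqI[of _ _ "(u, v)"])
  qed
qed

lemma graph_radius_arc_iso:
  assumes "arc_iso h P E Q E'"
  shows "graph_radius c P E = graph_radius c Q E'"
  unfolding graph_radius_def
proof (rule max_eigenvalue_reindex)
  show bij: "bij_betw h P Q" using assms by (simp add: arc_iso_def)
  fix u v assume uv: "u \<in> P" "v \<in> P"
  have "h ` (E `` {u}) = E' `` {h u}"
  proof
    show "h ` (E `` {u}) \<subseteq> E' `` {h u}" using assms by (auto simp: arc_iso_def)
    show "E' `` {h u} \<subseteq> h ` (E `` {u})"
    proof
      fix w assume w: "w \<in> E' `` {h u}"
      then have "w \<in> h ` P" using assms by (auto simp: arc_iso_def bij_betw_def)
      then show "w \<in> h ` (E `` {u})" using w assms uv by (auto simp: arc_iso_def)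
    qed
  qed
  moreover have "inj_on h (E `` {u})"
    using assms by (auto simp: arc_iso_def bij_betw_def intro: inj_on_subset)
  ultimately have "card (E `` {u}) = card (E' `` {h u})" by (metis card_image)
  moreover have "u = v \<longleftrightarrow> h u = h v" using bij uv by (auto simp: bij_betw_def inj_on_def)
  moreover have "(u, v) \<in> E \<longleftrightarrow> (h u, h v) \<in> E'" using assms uv by (auto simp: arc_iso_def)
  ultimately show "graph_kernel c E u v = graph_kernel c E' (h u) (h v)"
    by (simp add: graph_kernel_def)
qed

lemma digraph_iso_if_arc_iso:
  assumes iso: "arc_iso h (pverts H) (parcs H) (pverts G) (parcs G)"
  shows "digraph_iso (with_proj G) (with_proj H)"
proof -
  have wf: "wf_digraph (with_proj H)"
    using iso by unfold_locales (auto simp: arc_iso_def)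
  define f where "f = \<lparr>iso_verts = h, iso_arcs = map_prod h h, iso_head = snd, iso_tail = fst\<rparr>"
  have inj: "inj_on h (pverts H)" using iso by (auto simp: arc_iso_def bij_betw_def)
  have "inj_on (map_prod h h) (pverts H \<times> pverts H)" using inj by (simp add: map_prod_inj_on)
  then have "inj_on (map_prod h h) (parcs H)"
    by (rule inj_on_subset) (use iso in \<open>auto simp: arc_iso_def\<close>)
  then have "pre_digraph.digraph_isomorphism (with_proj H) f"
    unfolding pre_digraph.digraph_isomorphism_def using wf inj by (auto simp: f_def)
  moreover have "with_proj G = app_iso f (with_proj H)"
  proof -
    have "h ` pverts H = pverts G" using iso by (auto simp: arc_iso_def bij_betw_def)
    then show ?thesis
      using arc_iso_image[OF iso] unfolding app_iso_def with_proj_def f_def by simp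
  qed
  ultimately have "digraph_iso (with_proj H) (with_proj G)" unfolding digraph_iso_def by blast
  then show ?thesis by (rule digraph_iso_swap[OF wf])
qed

context block
begin

lemma arc_iso_Z:
  assumes y: "y \<in> U - T" and x0: "x0 \<in> V - N"
  obtains h where
    "arc_iso h (pverts (Z_graph n k (n - b) b)) (parcs (Z_graph n k (n - b) b))
       (U \<union> V) (both_arcs (block_edges U V T N))"
    "arc_iso h (pverts (Z0_graph n k (n - b) b)) (parcs (Z0_graph n k (n - b) b))
       (U \<union> V) (both_arcs (block_edges U V T N - {(y, x0)}))"
proof -
  have nb: "n - b + b = n" "b < n" "k < n" using n_large bk by auto
  obtain hu where hu: "bij_betw hu {..<n} U" "\<And>i. i < n \<Longrightarrow> hu i \<in> T \<longleftrightarrow> i < b" "hu b = y"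
    using bij_betw_marked[OF fin(1) card(1) sub(1) card(3), of y b] y nb by auto
  obtain hv where hv: "bij_betw hv {..<n} V" "\<And>i. i < n \<Longrightarrow> hv i \<in> V - N \<longleftrightarrow> i < n - k" "hv 0 = x0"
    using bij_betw_marked[OF fin(2) card(2) _ card_compl(2), of x0 0] x0 nb by auto
  define h where "h = case_sum hv hu"
  let ?P = "Inl ` {..<n} \<union> Inr ` {..<n}"
  have hvV: "hv i \<in> V" and huU: "hu i \<in> U" if "i < n" for i
    using hv hu that by (auto simp: bij_betw_def)
  have hvN: "hv i \<in> N \<longleftrightarrow> \<not> i < n - k" if "i < n" for i
    using hv(2)[OF that] hvV[OF that] by auto
  have hux: "hu j = y \<longleftrightarrow> j = b" and hvx: "hv j = x0 \<longleftrightarrow> j = 0" if "j < n" for j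
    using hu hv nb that by (auto simp: bij_betw_def inj_on_def)
  have hvU: "hv i \<notin> U" and huV: "hu i \<notin> V" if "i < n" for i
    using hvV huU disj that by blast+
  have inl: "bij_betw h (Inl ` {..<n}) V" and inr: "bij_betw h (Inr ` {..<n}) U"
    using hv(1) hu(1) by (auto simp: bij_betw_def inj_on_def h_def image_image)
  have bij: "bij_betw h ?P (U \<union> V)"
    using bij_betw_combine[OF inl inr] disj by (simp add: Un_commute Int_commute)
  have Pv: "pverts (Z_graph n k (n - b) b) = ?P" "pverts (Z0_graph n k (n - b) b) = ?P"
    by (simp_all add: Z_graph_def Z0_graph_def nb)
  have bsub: "both_arcs (block_edges U V T N - D) \<subseteq> (U \<union> V) \<times> (U \<union> V)" for D
    by (auto simp: both_arcs_def block_edges_def)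
  have 1: "arc_iso h ?P (parcs (Z_graph n k (n - b) b)) (U \<union> V) (both_arcs (block_edges U V T N))"
    unfolding arc_iso_def
  proof (intro conjI ballI bij)
    show "parcs (Z_graph n k (n - b) b) \<subseteq> ?P \<times> ?P"
      by (auto simp: Z_graph_def Z_edges_def nb)
    show "both_arcs (block_edges U V T N) \<subseteq> (U \<union> V) \<times> (U \<union> V)" using bsub[of "{}"] by simp
    show "(s, t) \<in> parcs (Z_graph n k (n - b) b) \<longleftrightarrow> (h s, h t) \<in> both_arcs (block_edges U V T N)"
      if "s \<in> ?P" "t \<in> ?P" for s t
      using that by (auto simp: Z_graph_def Z_edges_def nb both_arcs_def block_edges_def h_def
          hvV huU hvU huV hvN hu(2))
  qed
  have 2: "arc_iso h ?P (parcs (Z0_graph n k (n - b) b)) (U \<union> V) (both_arcs (block_edges U V T N - {(y, x0)}))"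
    unfolding arc_iso_def
  proof (intro conjI ballI bij bsub)
    show "parcs (Z0_graph n k (n - b) b) \<subseteq> ?P \<times> ?P"
      by (auto simp: Z0_graph_def Z_graph_def Z_edges_def nb)
    have bd: "both_arcs (block_edges U V T N - {(y, x0)}) =
        both_arcs (block_edges U V T N) - {(y, x0), (x0, y)}"
      using disj y x0 by (auto simp: both_arcs_def block_edges_def)
    fix s t assume st: "s \<in> ?P" "t \<in> ?P"
    have hy: "h s = y \<longleftrightarrow> s = Inr b" if "s \<in> ?P" for s
    proof (cases s)
      case (Inl i)
      then have "hv i \<noteq> y" using that hvU[of i] y by auto
      then show ?thesis using Inl by (simp add: h_def)
    qed (use that hux in \<open>auto simp: h_def\<close>)
    have hx: "h s = x0 \<longleftrightarrow> s = Inl 0" if "s \<in> ?P" for s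
    proof (cases s)
      case (Inr i)
      then have "hu i \<noteq> x0" using that huV[of i] x0 by auto
      then show ?thesis using Inr by (simp add: h_def)
    qed (use that hvx in \<open>auto simp: h_def\<close>)
    have "(h s, h t) \<in> {(y, x0), (x0, y)} \<longleftrightarrow> (s, t) \<in> {(Inl 0, Inr b), (Inr b, Inl 0)}"
      using hy[OF st(1)] hy[OF st(2)] hx[OF st(1)] hx[OF st(2)] by auto
    moreover have "(s, t) \<in> parcs (Z_graph n k (n - b) b) \<longleftrightarrow> (h s, h t) \<in> both_arcs (block_edges U V T N)"
      using 1 st by (auto simp: arc_iso_def)
    ultimately show "(s, t) \<in> parcs (Z0_graph n k (n - b) b) \<longleftrightarrow>
        (h s, h t) \<in> both_arcs (block_edges U V T N - {(y, x0)})"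
      unfolding bd by (simp add: Z0_graph_def)
  qed
  show ?thesis using that[of h] 1 2 unfolding Pv by blast
qed

text \<open>
  The minimum degree makes every vertex of \<open>T\<close> adjacent to all of \<open>N\<close>, so \<open>G\<close> is \<open>F\<close>, or \<open>F\<^sup>0\<close>, or has too
  small a radius.
\<close>

lemma iso_if_radius_ge:
  assumes G: "pverts G = U \<union> V" "parcs G = both_arcs B" and B: "B \<subseteq> U \<times> V" "B `` T \<subseteq> N"
    and deg: "\<And>u. u \<in> U \<Longrightarrow> k \<le> card (B `` {u})" and "c \<ge> 0"
    and ge: "graph_radius c (U \<union> V) (both_arcs B) \<ge>
      graph_radius c (pverts (Z0_graph n k (n - b) b)) (parcs (Z0_graph n k (n - b) b))"
  shows "digraph_iso (with_proj G) (with_proj (Z_graph n k (n - b) b)) \<or>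
    digraph_iso (with_proj G) (with_proj (Z0_graph n k (n - b) b))"
proof -
  have "T \<times> N \<subseteq> B"
  proof -
    have "B `` {t} = N" if "t \<in> T" for t
      using that B(2) deg[of t] sub card by (intro card_seteq[OF finTN(2)]) auto
    then show ?thesis by blast
  qed
  moreover have "B \<subseteq> block_edges U V T N" using B by (auto simp: block_edges_def)
  ultimately consider "B = block_edges U V T N" |
    N' y x0 where "block U V T N' n b k" "y \<in> U - T" "x0 \<in> V - N'"
      "B = block_edges U V T N' - {(y, x0)} \<or>
       graph_radius c (U \<union> V) (both_arcs B) <
         graph_radius c (U \<union> V) (both_arcs (block_edges U V T N' - {(y, x0)}))"
    using radius_less_some_block[OF _ _ _ \<open>c \<ge> 0\<close>] by blast
  then show ?thesis
  proof cases
    case 1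
    obtain y x0 where "y \<in> U - T" "x0 \<in> V - N" using compl_nonempty by blast
    from arc_iso_Z[OF this] show ?thesis
      using digraph_iso_if_arc_iso[of _ "Z_graph n k (n - b) b" G] G 1 by metis
  next
    case 2
    then interpret N': block U V T N' n b k by simp
    obtain h where h: "arc_iso h (pverts (Z0_graph n k (n - b) b)) (parcs (Z0_graph n k (n - b) b))
       (U \<union> V) (both_arcs (block_edges U V T N' - {(y, x0)}))"
      using N'.arc_iso_Z[OF 2(2,3)] by blast
    have "B = block_edges U V T N' - {(y, x0)}"
      using 2(4) ge graph_radius_arc_iso[OF h, of c] by auto
    then show ?thesis
      using digraph_iso_if_arc_iso[of h "Z0_graph n k (n - b) b" G] G h by simp
  qed
qed

end

section \<open>Spectral conditions for Hamiltonicity after vertex deletion\<close>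

theorem corollary1p15:
  fixes q k n :: nat
    and G :: "'a pair_pre_digraph"
    and U V :: "'a set"
  assumes "pair_graph G"
    and "balanced_bipartition G U V"
    and "card (pverts G) = 2 * n"
    and "2 * n \<ge> 8 * k * (k + 1)"
    and "min_degree G \<ge> k"
    and "k \<ge> q + 1"
    and "adj_spectral_radius G \<ge> adj_spectral_radius (F0_graph n k (q + 1)) \<or>
         signless_spectral_radius G \<ge> signless_spectral_radius (F0_graph n k (q + 1))"
  shows "qq_Hamiltonian q G U V \<or>
         digraph_iso (with_proj G) (with_proj (F_graph n k (q + 1))) \<or>
         digraph_iso (with_proj G) (with_proj (F0_graph n k (q + 1)))"
proof (rule disj_commute[THEN iffD1, OF disjCI])
  assume nham: "\<not> qq_Hamiltonian q G U V"
  interpret pair_graph G by fact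
  define b where "b = k - q"
  have bk: "0 < b" "b \<le> k" "b + q = k" using assms(6) by (auto simp: b_def)
  have n: "4 * k * (k + 1) \<le> n" using assms(4) by simp
  have PG: "pverts G = U \<union> V" and disj: "U \<inter> V = {}" and arcs: "parcs G \<subseteq> U \<times> V \<union> V \<times> U"
    and cUV: "card U = card V"
    using assms(2) by (auto simp: balanced_bipartition_def)
  have fin: "finite U" "finite V" using pair_finite_verts PG by auto
  then have card: "card U = n" "card V = n"
    using assms(3) cUV disj by (simp_all add: PG card_Un_disjoint)
  define B where "B = parcs G \<inter> U \<times> V"
  have B: "B \<subseteq> U \<times> V" by (auto simp: B_def)
  have PA: "parcs G = both_arcs B"
    using arcs arcs_symmetric by (auto simp: B_def both_arcs_def)
  have deg: "k \<le> card (parcs G `` {w})" if "w \<in> U \<union> V" for w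
  proof -
    have "min_degree G \<le> out_degree (with_proj G) w"
      unfolding min_degree_def using that pair_finite_verts PG by (intro Min_le) auto
    then show ?thesis using assms(5) by (simp add: out_degree_with_proj)
  qed
  have degU: "k \<le> card (B `` {u})" if "u \<in> U" for u
  proof -
    have "parcs G `` {u} = B `` {u}" using that disj B unfolding PA both_arcs_def by blast
    then show ?thesis using deg[of u] that by simp
  qed
  have degV: "k \<le> card (B\<inverse> `` {v})" if "v \<in> V" for v
  proof -
    have "parcs G `` {v} = B\<inverse> `` {v}" using that disj B unfolding PA both_arcs_def by blast
    then show ?thesis using deg[of v] that by simp
  qed
  have n_gt: "k + 2 \<le> n"
  proof -
    have "k * k \<ge> k" using bk by (cases k) auto
    moreover have "4 * k * (k + 1) = 4 * (k * k) + 4 * k" by simp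
    ultimately show ?thesis using n bk by linarith
  qed
  have F: "F_graph n k (q + 1) = Z_graph n k (n - b) b" "F0_graph n k (q + 1) = Z0_graph n k (n - b) b"
  proof -
    have "n + (q + 1) - k - 1 = n - b" "k + 1 - (q + 1) = b" using bk n_gt by (auto simp: b_def)
    then show "F_graph n k (q + 1) = Z_graph n k (n - b) b"
      "F0_graph n k (q + 1) = Z0_graph n k (n - b) b"
      unfolding F_graph_def F0_graph_def by (simp_all only:)
  qed
  let ?Z0 = "Z0_graph n k (n - b) b"
  have finZ0: "finite (pverts ?Z0)" by (simp add: Z0_graph_def Z_graph_def)
  obtain c :: real where c: "c = 0 \<or> c = 1"
    and ge: "graph_radius c (pverts ?Z0) (parcs ?Z0) \<le> graph_radius c (U \<union> V) (both_arcs B)"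
    using assms(7) unfolding F spectral_radius_eq_graph_radius[OF finZ0]
      spectral_radius_eq_graph_radius[OF pair_finite_verts] PG PA by blast
  have c0: "c \<ge> 0" using c by auto
  have few: "card (U \<times> V - B) \<le> n * b + 1"
  proof -
    \<comment> \<open>any choice of \<open>T\<close> and \<open>N\<close> gives a copy of \<open>F\<^sup>0\<close> on the vertices of \<open>G\<close> to compare with\<close>
    obtain T where T: "T \<subseteq> U" "card T = b" using obtain_subset_with_card_n[of b U] card bk n_gt by auto
    obtain N where N: "N \<subseteq> V" "card N = k" using obtain_subset_with_card_n[of k V] card n_gt by auto
    interpret block U V T N n b k
      using fin disj card T N bk n by unfold_locales auto
    obtain y where y: "y \<in> U - T" using compl_nonempty(1) by blast
    obtain x0 where x0: "x0 \<in> V - N" using compl_nonempty(2) by blast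
    obtain h where h: "arc_iso h (pverts ?Z0) (parcs ?Z0)
       (U \<union> V) (both_arcs (block_edges U V T N - {(y, x0)}))"
      using arc_iso_Z[OF y x0] by blast
    have "both_arcs B `` {w} \<noteq> {}" if "w \<in> U \<union> V" for w
      using deg[OF that] bk unfolding PA by auto
    then show ?thesis
      using nonedges_le[OF B _ y x0 c] ge graph_radius_arc_iso[OF h, of c] by simp
  qed
  obtain S where S: "S \<subseteq> pverts G" "card (S \<inter> U) = q" "card (S \<inter> V) = q"
    "\<not> has_spanning_cycle (with_proj G \<restriction> (pverts G - S))"
    using nham unfolding qq_Hamiltonian_def by blast
  let ?S1 = "S \<inter> U" and ?S2 = "S \<inter> V"
  have "\<not> ham_bip (U - ?S1) (V - ?S2) (B \<inter> (U - ?S1) \<times> (V - ?S2))"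
  proof
    assume ham: "ham_bip (U - ?S1) (V - ?S2) (B \<inter> (U - ?S1) \<times> (V - ?S2))"
    have "card (U - ?S1) = n - q"
      using fin S(2) card by (subst card_Diff_subset) (auto intro: finite_subset)
    then have "card (U - ?S1) \<ge> 2" using n_gt bk by simp
    then have "has_spanning_cycle (with_proj G \<restriction> ((U - ?S1) \<union> (V - ?S2)))"
      using disj PG by (intro has_spanning_cycle_if_ham_bip[OF ham]) (auto simp: PA both_arcs_def)
    moreover have "(U - ?S1) \<union> (V - ?S2) = pverts G - S" using PG by auto
    ultimately show False using S(4) by simp
  qed
  then have "(\<exists>T\<subseteq>U. \<exists>N\<subseteq>V. card T = k - q \<and> card N = k \<and> B `` T \<subseteq> N) \<or>
         (\<exists>T\<subseteq>V. \<exists>N\<subseteq>U. card T = k - q \<and> card N = k \<and> B\<inverse> `` T \<subseteq> N)"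
    using degU degV few S(2,3) assms(6) bk
    by (intro extremal_block_if_nonhamiltonian[OF fin card B _ _ _ n, of q ?S1 ?S2])
      (auto simp: b_def)
  then show "digraph_iso (with_proj G) (with_proj (F_graph n k (q + 1))) \<or>
         digraph_iso (with_proj G) (with_proj (F0_graph n k (q + 1)))"
    unfolding b_def[symmetric]
  proof (elim disjE exE conjE)
    fix T N assume TN: "T \<subseteq> U" "N \<subseteq> V" "card T = b" "card N = k" "B `` T \<subseteq> N"
    interpret block U V T N n b k
      using fin disj card TN bk n by unfold_locales auto
    show ?thesis unfolding F
      by (rule iso_if_radius_ge[OF PG PA B TN(5) degU c0 ge])
  next
    fix T N assume TN: "T \<subseteq> V" "N \<subseteq> U" "card T = b" "card N = k" "B\<inverse> `` T \<subseteq> N"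
    interpret block V U T N n b k
      using fin disj card TN bk n by unfold_locales auto
    have sw: "both_arcs (B\<inverse>) = both_arcs B" "V \<union> U = U \<union> V" by (auto simp: both_arcs_def)
    show ?thesis unfolding F
      by (rule iso_if_radius_ge[of G "B\<inverse>", unfolded sw, OF PG PA _ TN(5) degV c0 ge]) (use B in auto)
  qed
qed

end
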